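(* Let $ds^2$ be a product cuspidal metric for a neighborhood of the origin in $(\mathbb R^2)^{m+n}$. A curve having first segment off the $x$-axes and second segment a geodesic in the $x$-axes is not $ds^2$ length-minimizing between its endpoints. There is a shorter curve (with the same endpoints) of the same description.
   Context: Consider $(\mathbb R^2)^{m+n}=\mathbb R^{2m}\times\mathbb R^{2n}$ with Euclidean coordinates $(x,y)$. The $x$-axes is $\mathbb R^{2m}\times\{0\}$ and the $y$-axes is $\{0\}\times\mathbb R^{2n}$. Let $(r_j,\theta_j)$, $j=1,\dots,n$, be polar coordinates for the $2$-plane with coordinates $(y_{2j-1},y_{2j})$; $r=(r_1,\dots,r_n)$, $\|r\|$ is the Euclidean norm of the radius vector for the $y$-axes, and $dr^2+r^6d\theta^2$ abbreviates the singular metric $\sum_{j=1}^n\bigl(4\,dr_j^2+r_j^6\,d\theta_j^2\bigr)$. Definition. A continuous symmetric $2$-tensor $ds^2$ is a product cuspidal metric for a neighborhood of the origin in $(\mathbb R^2)^{m+n}$ provided: (1) $ds^2$ is a smooth Riemannian metric on $\bigcap_{j=1}^n\{r_j>0\}$; (2) the restriction of $ds^2$ to the $x$-axes is a smooth Riemannian metric $ds_x^2$; (3) $ds^2=(d\mu^2+dr^2+r^6d\theta^2)(1+O(\|r\|^2))$, where $d\mu^2$ is the pullback of $ds_x^2$ to $(\mathbb R^2)^{m+n}$ by the projection onto the $x$-axes. Lengths of curves are computed with $ds^2$. "First segment off the $x$-axes and second segment a geodesic in the $x$-axes" means that the oriented curve has an initial segment disjoint from the $x$-axes up to a first contact point $\mathbf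 o$ with the $x$-axes, after which it is a (nontrivial) $ds_x^2$-geodesic segment in the $x$-axes starting from $\mathbf o$. *)

theory Defs
  imports "HOL-Analysis.Analysis"
begin

primrec Ck_on :: "nat \<Rightarrow> 'a::real_normed_vector set \<Rightarrow> ('a \<Rightarrow> real) \<Rightarrow> bool" where
  "Ck_on 0 S f \<longleftrightarrow> continuous_on S f"
| "Ck_on (Suc k) S f \<longleftrightarrow>
     (\<forall>x\<in>S. f differentiable (at x)) \<and> (\<forall>v. Ck_on k S (\<lambda>x. frechet_derivative f (at x) v))"

definition smooth_on :: "'a::real_normed_vector set \<Rightarrow> ('a \<Rightarrow> real) \<Rightarrow> bool" where
  "smooth_on S f \<longleftrightarrow> (\<forall>k. Ck_on k S f)"

type_synonym 'a tensor2 = "'a \<Rightarrow> 'a \<Rightarrow> 'a \<Rightarrow> real"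

definition symmetric_bilinear :: "('a::real_vector \<Rightarrow> 'a \<Rightarrow> real) \<Rightarrow> bool" where
  "symmetric_bilinear B \<longleftrightarrow> bilinear B \<and> (\<forall>v w. B v w = B w v)"

definition smooth_riemannian_metric_on :: "'a::real_normed_vector set \<Rightarrow> 'a tensor2 \<Rightarrow> bool" where
  "smooth_riemannian_metric_on S G \<longleftrightarrow>
     (\<forall>p\<in>S. symmetric_bilinear (G p) \<and> (\<forall>v. v \<noteq> 0 \<longrightarrow> G p v v > 0)) \<and>
     (\<forall>v w. smooth_on S (\<lambda>p. G p v w))"

text \<open>Christoffel symbols of the first kind, contracted with constant vectors:
  \<open>christoffel1 G p u v w = G p (\<nabla>\<^bsub>u\<^esub> v) w\<close> for the Levi-Civita connection of \<open>G\<close>.\<close>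

definition christoffel1 :: "('a::real_normed_vector) tensor2 \<Rightarrow> 'a \<Rightarrow> 'a \<Rightarrow> 'a \<Rightarrow> 'a \<Rightarrow> real" where
  "christoffel1 G p u v w =
     (frechet_derivative (\<lambda>z. G z v w) (at p) u
      + frechet_derivative (\<lambda>z. G z u w) (at p) v
      - frechet_derivative (\<lambda>z. G z u v) (at p) w) / 2"

text \<open>Affinely parametrized geodesics: the last conjunct is the geodesic equation
  \<open>\<nabla>\<^bsub>\<sigma>'\<^esub> \<sigma>' = 0\<close> with its index lowered by \<open>G\<close>. Constant curves satisfy it.\<close>

definition geodesic_on :: "('a::real_normed_vector) tensor2 \<Rightarrow> real \<Rightarrow> real \<Rightarrow> (real \<Rightarrow> 'a) \<Rightarrow> bool" where
  "geodesic_on G a b \<sigma> \<longleftrightarrow>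
     (\<exists>\<sigma>' \<sigma>''. \<forall>t\<in>{a..b}.
        (\<sigma> has_vector_derivative \<sigma>' t) (at t within {a..b}) \<and>
        (\<sigma>' has_vector_derivative \<sigma>'' t) (at t within {a..b}) \<and>
        (\<forall>w. G (\<sigma> t) (\<sigma>'' t) w + christoffel1 G (\<sigma> t) (\<sigma>' t) (\<sigma>' t) w = 0))"

text \<open>The space \<open>(\<real>\<^sup>2)\<^bsup>m+n\<^esup>\<close>, with coordinates \<open>(x, y)\<close>; the \<open>j\<close>-th plane of the \<open>y\<close>-factor
  is \<open>y $ j\<close>. Polar coordinates are triples \<open>(x, r, \<theta>)\<close>.\<close>

type_synonym ('m, 'n) space = "(real^2^'m) \<times> (real^2^'n)"
type_synonym ('m, 'n) polar_space = "(real^2^'m) \<times> (real^'n) \<times> (real^'n)"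

definition polar :: "('m::finite, 'n::finite) polar_space \<Rightarrow> ('m, 'n) space" where
  "polar = (\<lambda>(x, r, \<theta>). (x, \<chi> j. r $ j *\<^sub>R vector [cos (\<theta> $ j), sin (\<theta> $ j)]))"

definition polar_domain :: "('m::finite, 'n::finite) space set \<Rightarrow> ('m, 'n) polar_space set" where
  "polar_domain U = {(x, r, \<theta>). (\<forall>j. 0 \<le> r $ j) \<and> polar (x, r, \<theta>) \<in> U}"

text \<open>Tangency to the stratum through the given point: a plane coordinate that
  vanishes there must stay zero to first order.\<close>

definition stratum_tangent :: "('m::finite, 'n::finite) polar_space \<Rightarrow> ('m, 'n) polar_space \<Rightarrow> bool" where
  "stratum_tangent = (\<lambda>(x, r, \<theta>) (\<xi>, \<rho>, \<tau>). \<forall>j. r $ j = 0 \<longrightarrow> \<rho> $ j = 0)"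

text \<open>The tensor \<open>4 dr\<^sub>j\<^sup>2\<close> has no continuous extension to \<open>r\<^sub>j = 0\<close> in the Cartesian
  coordinates of the \<open>j\<close>-th plane, so continuity of the metric must be understood
  in the coordinates \<open>(x, r, \<theta>)\<close>, \<open>r\<^sub>j \<ge> 0\<close>. Here \<open>h\<close> is the expression of \<open>g\<close> in these
  coordinates. Where all \<open>r\<^sub>j > 0\<close> it is the pullback of \<open>g\<close>; where some \<open>r\<^sub>j = 0\<close> it
  is the continuous extension, and \<open>g\<close> has to agree with it on vectors tangent to the stratum.
  Values of \<open>g\<close> on vectors transverse to a stratum are left open; they do not affect lengths,
  because the velocity of a piecewise \<open>C\<^sup>1\<close> curve is tangent to the strata at all but
  countably many times.\<close>

definition continuous_polar_form ::
  "('m::finite, 'n::finite) space set \<Rightarrow> ('m, 'n) space tensor2 \<Rightarrow> ('m, 'n) polar_space tensor2 \<Rightarrow> bool" where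
  "continuous_polar_form U g h \<longleftrightarrow>
     (\<forall>q\<in>polar_domain U. symmetric_bilinear (h q)) \<and>
     (\<forall>V W. continuous_on (polar_domain U) (\<lambda>q. h q V W)) \<and>
     (\<forall>q\<in>polar_domain U. \<forall>V W. stratum_tangent q V \<longrightarrow> stratum_tangent q W \<longrightarrow>
        h q V W = g (polar q) (frechet_derivative polar (at q) V) (frechet_derivative polar (at q) W))"

definition axes_metric :: "('m::finite, 'n::finite) space tensor2 \<Rightarrow> (real^2^'m) tensor2" where
  "axes_metric g = (\<lambda>x v w. g (x, 0) (v, 0) (w, 0))"

text \<open>The quadratic form of \<open>d\<mu>\<^sup>2 + \<Sum>\<^sub>j (4 dr\<^sub>j\<^sup>2 + r\<^sub>j\<^sup>6 d\<theta>\<^sub>j\<^sup>2)\<close>.\<close>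

definition cusp_model :: "('m::finite, 'n::finite) space tensor2 \<Rightarrow>
    ('m, 'n) polar_space \<Rightarrow> ('m, 'n) polar_space \<Rightarrow> real" where
  "cusp_model g = (\<lambda>(x, r, \<theta>) (\<xi>, \<rho>, \<tau>).
     axes_metric g x \<xi> \<xi> + (\<Sum>j\<in>UNIV. 4 * (\<rho> $ j)\<^sup>2 + (r $ j)^6 * (\<tau> $ j)\<^sup>2))"

text \<open>\<open>U\<close> is required to contain its projection to the \<open>x\<close>-axes, so that \<open>d\<mu>\<^sup>2\<close> is defined
  on all of \<open>U\<close>. The factor \<open>1 + O(\<parallel>r\<parallel>\<^sup>2)\<close> is a comparison of quadratic forms.\<close>

definition product_cuspidal_metric ::
  "('m::finite, 'n::finite) space set \<Rightarrow> ('m, 'n) space tensor2 \<Rightarrow> bool" where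
  "product_cuspidal_metric U g \<longleftrightarrow>
     open U \<and> (0, 0) \<in> U \<and> (\<forall>x y. (x, y) \<in> U \<longrightarrow> (x, 0) \<in> U) \<and>
     (\<forall>p\<in>U. symmetric_bilinear (g p)) \<and>
     smooth_riemannian_metric_on {(x, y) \<in> U. \<forall>j. y $ j \<noteq> 0} g \<and>
     smooth_riemannian_metric_on {x. (x, 0) \<in> U} (axes_metric g) \<and>
     (\<exists>h. continuous_polar_form U g h \<and>
        (\<exists>C. \<forall>x r \<theta> V. (x, r, \<theta>) \<in> polar_domain U \<longrightarrow>
           \<bar>h (x, r, \<theta>) V V - cusp_model g (x, r, \<theta>) V\<bar>
             \<le> C * (norm r)\<^sup>2 * cusp_model g (x, r, \<theta>) V))"

definition curve_in :: "'a::real_normed_vector set \<Rightarrow> real \<Rightarrow> real \<Rightarrow> (real \<Rightarrow> 'a) \<Rightarrow> bool" where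
  "curve_in U a b \<gamma> \<longleftrightarrow> a \<le> b \<and> \<gamma> piecewise_C1_differentiable_on {a..b} \<and> \<gamma> ` {a..b} \<subseteq> U"

definition curve_length :: "('a::real_normed_vector) tensor2 \<Rightarrow> real \<Rightarrow> real \<Rightarrow> (real \<Rightarrow> 'a) \<Rightarrow> ennreal" where
  "curve_length g a b \<gamma> =
     (\<integral>\<^sup>+t\<in>{a..b}. ennreal (sqrt (g (\<gamma> t) (vector_derivative \<gamma> (at t)) (vector_derivative \<gamma> (at t)))) \<partial>lborel)"

definition length_minimizing ::
  "'a::real_normed_vector set \<Rightarrow> 'a tensor2 \<Rightarrow> real \<Rightarrow> real \<Rightarrow> (real \<Rightarrow> 'a) \<Rightarrow> bool" where
  "length_minimizing U g a b \<gamma> \<longleftrightarrow>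
     (\<forall>a' b' \<delta>. curve_in U a' b' \<delta> \<and> \<delta> a' = \<gamma> a \<and> \<delta> b' = \<gamma> b \<longrightarrow>
        curve_length g a b \<gamma> \<le> curve_length g a' b' \<delta>)"

definition off_axes_then_geodesic ::
  "('m::finite, 'n::finite) space set \<Rightarrow> ('m, 'n) space tensor2 \<Rightarrow> real \<Rightarrow> real \<Rightarrow>
     (real \<Rightarrow> ('m, 'n) space) \<Rightarrow> bool" where
  "off_axes_then_geodesic U g a b \<gamma> \<longleftrightarrow>
     curve_in U a b \<gamma> \<and>
     (\<exists>c. a < c \<and> c < b \<and>
        (\<forall>t\<in>{a..<c}. snd (\<gamma> t) \<noteq> 0) \<and>
        (\<forall>t\<in>{c..b}. snd (\<gamma> t) = 0) \<and>
        geodesic_on (axes_metric g) c b (fst \<circ> \<gamma>) \<and>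
        \<not> (fst \<circ> \<gamma>) constant_on {c..b})"

end

theory Submission
  imports Defs
begin

text \<open>
The idea is that a corner made by leaving the geodesic and running off the \<open>x\<close>-axes can always be
cut. Near the axes the metric is, up to a factor \<open>1 + O(r\<^sup>2)\<close>, the product of \<open>ds\<^sub>x\<^sup>2\<close> with the
cuspidal factor \<open>4 dr\<^sup>2 + r\<^sup>6 d\<theta>\<^sup>2\<close>; in the product the length of a curve is bounded below by Pythagoras from
its \<open>ds\<^sub>x\<^sup>2\<close>-length and the change of \<open>2 norm y\<close>.

Let the curve reach the axes at time \<open>c\<close>. Take a time \<open>t\<^sub>0 < c\<close> close to \<open>c\<close> at which \<open>norm y\<close> is maximal
over a terminal interval before \<open>c\<close>, let \<open>r\<close> be that maximum and \<open>l\<close> the \<open>ds\<^sub>x\<^sup>2\<close>-length of the projection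
of the curve over \<open>[t\<^sub>0, c]\<close>. Because \<open>norm y\<close> falls from \<open>r\<close> to \<open>0\<close> there, this piece has length at
least \<open>(1 - C r\<^sup>2) sqrt (l\<^sup>2 + 4 r\<^sup>2)\<close> (\<open>curve_length_ge\<close>).

The competitor \<open>freeze_drop\<close> keeps the \<open>x\<close>-component of the curve at all times. From \<open>t\<^sub>0\<close> on it holds
\<open>y\<close> fixed, passes over the old contact point at height \<open>r\<close>, and only later, over a fixed interval
\<open>[c\<^sub>1, c\<^sub>2]\<close> on which the geodesic is moving, scales \<open>y\<close> linearly to \<open>0\<close>. Holding \<open>y\<close> fixed costs
\<open>(1 + C r\<^sup>2) l\<close> over \<open>[t\<^sub>0, c]\<close>, and the slow descent adds only \<open>O(r\<^sup>2)\<close> to the length of the geodesic,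
because up to the factor \<open>1 + O(r\<^sup>2)\<close> the speed is there the square root of \<open>v\<^sup>2 + O(r\<^sup>2)\<close> with the
horizontal speed \<open>v\<close> bounded below (\<open>curve_length_le\<close>). The balance is
\<open>sqrt (l\<^sup>2 + 4 r\<^sup>2) - l = 4 r\<^sup>2 / (sqrt (l\<^sup>2 + 4 r\<^sup>2) + l)\<close> against \<open>O(r\<^sup>2)\<close>, and both \<open>l\<close> and \<open>r\<close> tend to \<open>0\<close>
as \<open>t\<^sub>0\<close> tends to \<open>c\<close>, so the gain wins (\<open>shortcut_arithmetic\<close>). The new curve follows the old
\<open>x\<close>-component, so its tail on the axes is a part of the given geodesic, and it is not constant since the
geodesic moves at \<open>c\<^sub>2\<close>.

The argument requires \<open>l\<close> to tend to \<open>0\<close>, which holds when the curve has finite length. A piecewise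
\<open>C\<^sup>1\<close> curve may have unbounded velocity at its break points and infinite length; then any curve of finite
length of the same description will do, and \<open>finite_length_competitor\<close> builds one from a polynomial
path off the axes, a straight segment down to the contact point, and the geodesic.
\<close>

section \<open>The metric in polar coordinates\<close>

lemma has_derivative_vec_lambda:
  fixes f :: "'a::real_normed_vector \<Rightarrow> 'b::euclidean_space ^ 'n::finite"
  assumes "\<And>i. ((\<lambda>x. f x $ i) has_derivative (\<lambda>h. f' h $ i)) (at x within S)"
  shows "(f has_derivative f') (at x within S)"
  unfolding has_derivative_componentwise_within[of f]
proof
  fix b :: "'b ^ 'n" assume "b \<in> Basis"
  then obtain k c where b: "b = axis k c" by (auto simp: Basis_vec_def)
  show "((\<lambda>x. f x \<bullet> b) has_derivative (\<lambda>x. f' x \<bullet> b)) (at x within S)"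
    unfolding b inner_axis using assms[of k] by (rule has_derivative_inner_left)
qed

lemma polar_has_derivative:
  fixes x :: "real^2^'m::finite" and r \<theta> :: "real^'n::finite"
  shows "(polar has_derivative (\<lambda>(\<xi>, \<rho>, \<tau>). (\<xi>, \<chi> j. \<rho> $ j *\<^sub>R vector [cos (\<theta> $ j), sin (\<theta> $ j)]
      + (r $ j * \<tau> $ j) *\<^sub>R vector [- sin (\<theta> $ j), cos (\<theta> $ j)]))) (at (x, r, \<theta>))"
proof -
  have nth: "((\<lambda>q. f q $ j) has_derivative (\<lambda>h. f' h $ j)) F"
    if "(f has_derivative f') F" for f f' :: "'z::real_normed_vector \<Rightarrow> real^'n" and j F
    using bounded_linear.has_derivative[OF bounded_linear_vec_nth that] .
  have "((\<lambda>q. snd (polar q) :: real^2^'n) has_derivative (\<lambda>h. (\<chi> j. fst (snd h) $ j *\<^sub>R vector [cos (\<theta> $ j), sin (\<theta> $ j)]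
      + (r $ j * snd (snd h) $ j) *\<^sub>R vector [- sin (\<theta> $ j), cos (\<theta> $ j)]))) (at (x, r, \<theta>))"
  proof (intro has_derivative_vec_lambda)
    fix j :: 'n and i :: 2
    show "((\<lambda>q. snd (polar q :: ('m, 'n) space) $ j $ i) has_derivative
        (\<lambda>h. (\<chi> j. fst (snd h) $ j *\<^sub>R vector [cos (\<theta> $ j), sin (\<theta> $ j)]
          + (r $ j * snd (snd h) $ j) *\<^sub>R vector [- sin (\<theta> $ j), cos (\<theta> $ j)]) $ j $ i)) (at (x, r, \<theta>))"
      using exhaust_2[of i]
      by (auto simp: polar_def case_prod_unfold intro!: derivative_eq_intros nth)
  qed
  moreover have "((\<lambda>q. fst (polar q) :: real^2^'m) has_derivative fst) (at (x, r, \<theta>))"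
    by (auto simp: polar_def case_prod_unfold intro!: derivative_eq_intros)
  ultimately have "((\<lambda>q. (fst (polar q) :: real^2^'m, snd (polar q) :: real^2^'n)) has_derivative 
     (\<lambda>h. (fst h, \<chi> j. fst (snd h) $ j *\<^sub>R vector [cos (\<theta> $ j), sin (\<theta> $ j)]
      + (r $ j * snd (snd h) $ j) *\<^sub>R vector [- sin (\<theta> $ j), cos (\<theta> $ j)]))) (at (x, r, \<theta>))"
    by (rule has_derivative_Pair[rotated])
  then show ?thesis by (simp add: case_prod_unfold)
qed

text \<open>The polar frame of a plane provides the components \<open>(\<rho>, \<tau>)\<close> of a velocity \<open>w\<close> at \<open>y\<close>. At the origin the
angle is arbitrary and every \<open>\<tau>\<close> is mapped to \<open>0\<close>, so a preimage tangent to the stratum, one with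
\<open>\<rho> = 0\<close>, exists only for \<open>w = 0\<close>.\<close>

lemma plane_polar_decomposition:
  fixes y w :: "real^2"
  assumes "y = 0 \<Longrightarrow> w = 0"
  obtains \<theta> \<rho> \<tau> where "y = norm y *\<^sub>R vector [cos \<theta>, sin \<theta>]"
    and "w = \<rho> *\<^sub>R vector [cos \<theta>, sin \<theta>] + (norm y * \<tau>) *\<^sub>R vector [- sin \<theta>, cos \<theta>]"
    and "y = 0 \<Longrightarrow> \<rho> = 0" and "y \<bullet> w = norm y * \<rho>"
    and "\<rho>\<^sup>2 + (norm y)\<^sup>2 * \<tau>\<^sup>2 = (norm w)\<^sup>2"
proof (cases "y = 0")
  case True
  then show ?thesis using that[of 0 0 0] assms by simp
next
  case False
  have n2: "(norm v)\<^sup>2 = (v $ 1)\<^sup>2 + (v $ 2)\<^sup>2" for v :: "real^2"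
    unfolding power2_norm_eq_inner by (simp add: inner_vec_def sum_2 power2_eq_square)
  define R where "R = norm y"
  have R: "R > 0" using False by (simp add: R_def)
  have R2: "R\<^sup>2 = (y $ 1)\<^sup>2 + (y $ 2)\<^sup>2" using n2[of y] R_def by simp
  have "(y $ 1 / R)\<^sup>2 + (y $ 2 / R)\<^sup>2 = 1"
    using R unfolding power_divide add_divide_distrib[symmetric] R2[symmetric] by simp
  then obtain \<theta> where th: "y $ 1 / R = cos \<theta>" "y $ 2 / R = sin \<theta>"
    using sincos_total_2pi[of "y $ 1 / R" "y $ 2 / R"] by metis
  define c s where "c = cos \<theta>" and "s = sin \<theta>"
  have cs: "c\<^sup>2 + s\<^sup>2 = 1" by (simp add: c_def s_def)
  have y: "y $ 1 = R * c" "y $ 2 = R * s" using th R by (auto simp: field_simps c_def s_def)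
  define \<rho> where "\<rho> = w $ 1 * c + w $ 2 * s"
  define \<tau> where "\<tau> = (w $ 2 * c - w $ 1 * s) / R"
  have Rt: "R * \<tau> = w $ 2 * c - w $ 1 * s" using R by (simp add: \<tau>_def)
  have w1: "w $ 1 = \<rho> * c - R * \<tau> * s"
    unfolding Rt \<rho>_def using cs by algebra
  have w2: "w $ 2 = \<rho> * s + R * \<tau> * c"
    unfolding Rt \<rho>_def using cs by algebra
  show ?thesis
  proof (rule that[of \<theta> \<rho> \<tau>])
    show "y = norm y *\<^sub>R vector [cos \<theta>, sin \<theta>]"
      using y by (simp add: vec_eq_iff forall_2 R_def c_def s_def)
    show "w = \<rho> *\<^sub>R vector [cos \<theta>, sin \<theta>] + (norm y * \<tau>) *\<^sub>R vector [- sin \<theta>, cos \<theta>]"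
      using w1 w2 by (simp add: vec_eq_iff forall_2 R_def c_def s_def)
    show "y = 0 \<Longrightarrow> \<rho> = 0" using False by simp
    show "y \<bullet> w = norm y * \<rho>"
      using y by (simp add: inner_vec_def sum_2 R_def[symmetric] \<rho>_def algebra_simps)
    have "\<rho>\<^sup>2 + (R * \<tau>)\<^sup>2 = (norm w)\<^sup>2"
      unfolding n2 Rt \<rho>_def using cs by algebra
    then show "\<rho>\<^sup>2 + (norm y)\<^sup>2 * \<tau>\<^sup>2 = (norm w)\<^sup>2" by (simp add: R_def power_mult_distrib)
  qed
qed

lemma norm2_vec: "(norm (y :: 'a::real_inner ^ 'n::finite))\<^sup>2 = (\<Sum>j\<in>UNIV. (norm (y $ j))\<^sup>2)"
  by (simp add: power2_norm_eq_inner inner_vec_def)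

text \<open>The two sides of the cuspidal asymptotics in Cartesian form, for velocities tangent to the stratum.
The coefficient \<open>4 + (norm y)^4\<close> covers both \<open>4 \<rho>\<^sup>2\<close> and \<open>r\<^sup>6 \<tau>\<^sup>2\<close>, so the upper bound forgets angles. In
the lower bound \<open>(y \<bullet> w) / norm y\<close> is the rate of change of \<open>norm y\<close>; it keeps the full coefficient
\<open>4\<close>, and its value at \<open>y = 0\<close> is \<open>0\<close>, as it should be for a tangent velocity. The lower bound
discards angular terms of the model, which requires a nonnegative error factor, hence small \<open>y\<close>.\<close>

locale cuspidal_estimates =
  fixes U :: "('m::finite, 'n::finite) space set" and g :: "('m, 'n) space tensor2" and C :: real
  assumes open_U: "open U"
    and axes_U: "(x, y) \<in> U \<Longrightarrow> (x, 0) \<in> U"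
    and riem: "smooth_riemannian_metric_on {x. (x, 0) \<in> U} (axes_metric g)"
    and C_nonneg: "C \<ge> 0"
    and upper: "(x, y) \<in> U \<Longrightarrow> (\<And>j. y $ j = 0 \<Longrightarrow> w $ j = 0) \<Longrightarrow>
      g (x, y) (u, w) (u, w)
        \<le> (1 + C * (norm y)\<^sup>2) * (axes_metric g x u u + (4 + (norm y) ^ 4) * (norm w)\<^sup>2)"
    and lower: "(x, y) \<in> U \<Longrightarrow> (\<And>j. y $ j = 0 \<Longrightarrow> w $ j = 0) \<Longrightarrow> C * (norm y)\<^sup>2 \<le> 1 \<Longrightarrow>
      (1 - C * (norm y)\<^sup>2) * (axes_metric g x u u + 4 * ((y \<bullet> w) / norm y)\<^sup>2)
        \<le> g (x, y) (u, w) (u, w)"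

text \<open>A tangent velocity is the image of a polar one that is tangent to the stratum, so \<open>g\<close> agrees on it
with the continuous polar form and is compared there with the model. The lower bound for the model
drops the angular terms and estimates \<open>\<Sum>\<^sub>j r\<^sub>j \<rho>\<^sub>j\<close> by the Cauchy-Schwarz inequality.\<close>

lemma product_cuspidal_metric_estimates:
  fixes U :: "('m::finite, 'n::finite) space set"
  assumes "product_cuspidal_metric U g"
  obtains C where "cuspidal_estimates U g C"
proof -
  from assms obtain h C0 where h: "continuous_polar_form U g h"
    and C0: "\<And>x r \<theta> V. (x, r, \<theta>) \<in> polar_domain U \<Longrightarrow>
           \<bar>h (x, r, \<theta>) V V - cusp_model g (x, r, \<theta>) V\<bar>
             \<le> C0 * (norm r)\<^sup>2 * cusp_model g (x, r, \<theta>) V"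
    unfolding product_cuspidal_metric_def by blast
  from assms have proj: "\<And>x y. (x, y) \<in> U \<Longrightarrow> (x, 0) \<in> U"
    and pos: "smooth_riemannian_metric_on {x. (x, 0) \<in> U} (axes_metric g)"
    unfolding product_cuspidal_metric_def by auto
  have G0: "axes_metric g x u u \<ge> 0" if "(x, 0) \<in> U" for x u
  proof (cases "u = 0")
    case True
    with pos that have "bilinear (axes_metric g x)"
      by (auto simp: smooth_riemannian_metric_on_def symmetric_bilinear_def)
    then show ?thesis using True by (simp add: bilinear_lzero)
  next
    case False
    then show ?thesis using pos that by (auto simp: smooth_riemannian_metric_on_def intro: less_imp_le)
  qed
  \<comment> \<open>The given constant may be negative.\<close>
  define C where "C = max C0 0"
  have key: "\<exists>Q. g (x, y) (u, w) (u, w) \<le> (1 + C * (norm y)\<^sup>2) * Q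
      \<and> (1 - C * (norm y)\<^sup>2) * Q \<le> g (x, y) (u, w) (u, w)
      \<and> axes_metric g x u u + 4 * ((y \<bullet> w) / norm y)\<^sup>2 \<le> Q
      \<and> Q \<le> axes_metric g x u u + (4 + (norm y) ^ 4) * (norm w)\<^sup>2"
    if xy: "(x, y) \<in> U" and tan: "\<And>j. y $ j = 0 \<Longrightarrow> w $ j = 0" for x y u w
  proof -
    have "\<forall>j. \<exists>\<theta> \<rho> \<tau>. y $ j = norm (y $ j) *\<^sub>R vector [cos \<theta>, sin \<theta>] \<and>
      w $ j = \<rho> *\<^sub>R vector [cos \<theta>, sin \<theta>] + (norm (y $ j) * \<tau>) *\<^sub>R vector [- sin \<theta>, cos \<theta>] \<and>
      (y $ j = 0 \<longrightarrow> \<rho> = 0) \<and> (y $ j) \<bullet> (w $ j) = norm (y $ j) * \<rho> \<and>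
      \<rho>\<^sup>2 + (norm (y $ j))\<^sup>2 * \<tau>\<^sup>2 = (norm (w $ j))\<^sup>2"
      using plane_polar_decomposition tan by metis
    then obtain T P S where pj: "\<And>j. y $ j = norm (y $ j) *\<^sub>R vector [cos (T j), sin (T j)]"
      "\<And>j. w $ j = P j *\<^sub>R vector [cos (T j), sin (T j)] + (norm (y $ j) * S j) *\<^sub>R vector [- sin (T j), cos (T j)]"
      "\<And>j. y $ j = 0 \<Longrightarrow> P j = 0" "\<And>j. (y $ j) \<bullet> (w $ j) = norm (y $ j) * P j"
      "\<And>j. (P j)\<^sup>2 + (norm (y $ j))\<^sup>2 * (S j)\<^sup>2 = (norm (w $ j))\<^sup>2"
      by metis
    define r \<theta> \<rho> \<tau> where "r = (\<chi> j. norm (y $ j))" and "\<theta> = (\<chi> j. T j)" and "\<rho> = (\<chi> j. P j)" and "\<tau> = (\<chi> j. S j)"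
    note defs = r_def \<theta>_def \<rho>_def \<tau>_def
    have nr: "norm r = norm y"
      by (simp add: norm_vec_def r_def)
    have pol: "polar (x, r, \<theta>) = (x, y)"
      using pj(1) by (simp add: polar_def defs vec_eq_iff[of _ y])
    have dom: "(x, r, \<theta>) \<in> polar_domain U"
      using xy pol by (simp add: polar_domain_def r_def)
    have fd: "frechet_derivative polar (at (x, r, \<theta>)) (u, \<rho>, \<tau>) = (u, w)"
      using pj(2) by (simp add: frechet_derivative_at[OF polar_has_derivative, symmetric] defs vec_eq_iff[of _ w])
    have "stratum_tangent (x, r, \<theta>) (u, \<rho>, \<tau>)"
      using pj(3) by (auto simp: stratum_tangent_def defs)
    then have hg: "h (x, r, \<theta>) (u, \<rho>, \<tau>) (u, \<rho>, \<tau>) = g (x, y) (u, w) (u, w)"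
      using h dom fd pol by (auto simp: continuous_polar_form_def)
    define Q where "Q = cusp_model g (x, r, \<theta>) (u, \<rho>, \<tau>)"
    have Q: "Q = axes_metric g x u u + (\<Sum>j\<in>UNIV. 4 * (P j)\<^sup>2 + (norm (y $ j))^6 * (S j)\<^sup>2)"
      by (simp add: Q_def cusp_model_def defs)
    have G: "axes_metric g x u u \<ge> 0" using G0 proj xy by blast
    have Q0: "Q \<ge> 0" unfolding Q using G by (intro add_nonneg_nonneg sum_nonneg) auto
    have "\<bar>g (x, y) (u, w) (u, w) - Q\<bar> \<le> C0 * (norm y)\<^sup>2 * Q"
      using C0[OF dom, of "(u, \<rho>, \<tau>)"] by (simp add: hg nr Q_def)
    also have "\<dots> \<le> C * (norm y)\<^sup>2 * Q"
      by (intro mult_right_mono Q0) (auto simp: C_def)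
    finally have abs: "\<bar>g (x, y) (u, w) (u, w) - Q\<bar> \<le> C * (norm y)\<^sup>2 * Q" .
    have "\<bar>y \<bullet> w\<bar> \<le> norm y * norm \<rho>"
    proof -
      have "y \<bullet> w = r \<bullet> \<rho>" unfolding inner_vec_def[of y] inner_vec_def[of r] by (simp add: pj(4) defs)
      then show ?thesis using Cauchy_Schwarz_ineq2[of r \<rho>] nr by simp
    qed
    then have "\<bar>(y \<bullet> w) / norm y\<bar> \<le> norm \<rho>"
      by (cases "y = 0") (auto simp: field_simps)
    then have "((y \<bullet> w) / norm y)\<^sup>2 \<le> (norm \<rho>)\<^sup>2" by (metis abs_le_square_iff abs_norm_cancel)
    also have "\<dots> = (\<Sum>j\<in>UNIV. (P j)\<^sup>2)" by (simp add: norm2_vec defs)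
    finally have "4 * ((y \<bullet> w) / norm y)\<^sup>2 \<le> (\<Sum>j\<in>UNIV. 4 * (P j)\<^sup>2)"
      by (simp add: sum_distrib_left[symmetric])
    also have "\<dots> \<le> (\<Sum>j\<in>UNIV. 4 * (P j)\<^sup>2 + (norm (y $ j))^6 * (S j)\<^sup>2)"
      by (intro sum_mono) auto
    finally have lo: "axes_metric g x u u + 4 * ((y \<bullet> w) / norm y)\<^sup>2 \<le> Q" by (simp add: Q)
    \<comment> \<open>\<open>r\<^sub>j\<^sup>6 \<tau>\<^sub>j\<^sup>2 = r\<^sub>j\<^sup>4 (r\<^sub>j \<tau>\<^sub>j)\<^sup>2\<close>, and \<open>r\<^sub>j \<tau>\<^sub>j\<close> is a component of \<open>w $ j\<close>.\<close>
    have "4 * (P j)\<^sup>2 + (norm (y $ j))^6 * (S j)\<^sup>2 \<le> (4 + (norm y)^4) * (norm (w $ j))\<^sup>2" for j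
    proof -
      have "(norm (y $ j))^4 \<le> (norm y)^4" by (intro power_mono Finite_Cartesian_Product.norm_nth_le) auto
      then have "(norm (y $ j))^4 * ((norm (y $ j))\<^sup>2 * (S j)\<^sup>2) \<le> (norm y)^4 * ((norm (y $ j))\<^sup>2 * (S j)\<^sup>2)"
        by (intro mult_right_mono) auto
      moreover have "(norm (y $ j))^6 * (S j)\<^sup>2 = (norm (y $ j))^4 * ((norm (y $ j))\<^sup>2 * (S j)\<^sup>2)"
        by (simp add: power_numeral_reduce)
      moreover have "(norm y)^4 * (P j)\<^sup>2 \<ge> 0" "(norm (y $ j))\<^sup>2 * (S j)\<^sup>2 \<ge> 0" by auto
      ultimately have "4 * (P j)\<^sup>2 + (norm (y $ j))^6 * (S j)\<^sup>2
        \<le> 4 * (P j)\<^sup>2 + (norm y)^4 * ((norm (y $ j))\<^sup>2 * (S j)\<^sup>2)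
          + ((norm y)^4 * (P j)\<^sup>2 + 4 * ((norm (y $ j))\<^sup>2 * (S j)\<^sup>2))" by linarith
      also have "\<dots> = (4 + (norm y)^4) * (norm (w $ j))\<^sup>2"
        unfolding pj(5)[symmetric] by algebra
      finally show ?thesis .
    qed
    then have hi: "Q \<le> axes_metric g x u u + (4 + (norm y) ^ 4) * (norm w)\<^sup>2"
      unfolding Q norm2_vec[of w] sum_distrib_left by (intro add_left_mono sum_mono)
    show ?thesis using lo hi abs by (intro exI[of _ Q]) (auto simp: abs_le_iff algebra_simps)
  qed
  have "cuspidal_estimates U g C"
  proof
    show "open U" "smooth_riemannian_metric_on {x. (x, 0) \<in> U} (axes_metric g)"
      using assms by (simp_all add: product_cuspidal_metric_def)
    show "(x, 0) \<in> U" if "(x, y) \<in> U" for x y using proj[OF that] .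
    show "C \<ge> 0" by (simp add: C_def)
    then have C1: "1 + C * (norm y)\<^sup>2 \<ge> 0" for y :: "real^2^'n" by simp
    show "g (x, y) (u, w) (u, w)
        \<le> (1 + C * (norm y)\<^sup>2) * (axes_metric g x u u + (4 + (norm y) ^ 4) * (norm w)\<^sup>2)"
      if "(x, y) \<in> U" "\<And>j. y $ j = 0 \<Longrightarrow> w $ j = 0" for x y u w
      using key[OF that] mult_left_mono[OF _ C1] by (meson order_trans)
    show "(1 - C * (norm y)\<^sup>2) * (axes_metric g x u u + 4 * ((y \<bullet> w) / norm y)\<^sup>2)
        \<le> g (x, y) (u, w) (u, w)"
      if "(x, y) \<in> U" "\<And>j. y $ j = 0 \<Longrightarrow> w $ j = 0" "C * (norm y)\<^sup>2 \<le> 1" for x y u w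
      using key[OF that(1,2)] mult_left_mono[of _ _ "1 - C * (norm y)\<^sup>2"] that(3)
      by (smt (verit) that(3))
  qed
  then show ?thesis by (rule that)
qed

section \<open>Times at which the velocity leaves the stratum\<close>

lemma isolated_imp_countable: 
  fixes X :: "real set"
  assumes "\<And>t. t \<in> X \<Longrightarrow> \<exists>V. open V \<and> t \<in> V \<and> V \<inter> X \<subseteq> {t}"
  shows "countable X"
proof -
  have "\<forall>t\<in>X. \<exists>V. open V \<and> t \<in> V \<and> V \<inter> X \<subseteq> {t}" using assms by blast
  from bchoice[OF this] obtain V
    where V: "\<And>t. t \<in> X \<Longrightarrow> open (V t) \<and> t \<in> V t \<and> V t \<inter> X \<subseteq> {t}"
    by blast
  define W where "W = (\<Union>t\<in>X. V t)"
  have openW: "open W" unfolding W_def using V by blast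
  have "X sparse_in W"
    unfolding sparse_in_open[OF openW]
  proof safe
    fix s assume "s \<in> W" and lim: "s islimpt X"
    then obtain t where t: "t \<in> X" "s \<in> V t" unfolding W_def by blast
    then have fin: "finite (V t \<inter> X)" using V finite_subset[of "V t \<inter> X" "{t}"] by blast
    have "s islimpt (V t \<inter> X)"
    proof (rule islimptI)
      fix T assume "s \<in> T" "open T"
      then have "s \<in> T \<inter> V t" "open (T \<inter> V t)" using t(2) V[OF t(1)] by blast+
      then show "\<exists>y\<in>V t \<inter> X. y \<in> T \<and> y \<noteq> s"
        using islimptE[OF lim, of "T \<inter> V t"] by blast
    qed
    then show False using fin islimpt_finite by blast
  qed
  then have "countable (W \<inter> X)"
    using openW by (intro sparse_imp_countable)
  moreover have "W \<inter> X = X" using V unfolding W_def by blast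
  ultimately show ?thesis by simp
qed

text \<open>Such zeros are isolated, as the difference quotient tends to a nonzero limit.\<close>

lemma countable_transversal_zeros:
  fixes f :: "real \<Rightarrow> 'a::real_inner"
  shows "countable {t. f t = 0 \<and> (\<exists>d. d \<noteq> 0 \<and> (f has_vector_derivative d) (at t))}" (is "countable ?X")
proof (rule isolated_imp_countable)
  fix t assume "t \<in> ?X"
  then obtain d where d: "d \<noteq> 0" "(f has_vector_derivative d) (at t)" and ft: "f t = 0"
    by blast
  have "((\<lambda>s. f s \<bullet> d) has_vector_derivative d \<bullet> d) (at t)"
    by (rule bounded_linear.has_vector_derivative[OF bounded_linear_inner_left d(2)])
  then have "((\<lambda>s. (f s \<bullet> d - f t \<bullet> d) / (s - t)) \<longlongrightarrow> d \<bullet> d) (at t)"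
    by (simp add: has_real_derivative_iff_has_vector_derivative[symmetric] has_field_derivative_iff)
  then have "\<forall>\<^sub>F s in at t. (f s \<bullet> d - f t \<bullet> d) / (s - t) \<noteq> 0"
    by (rule tendsto_imp_eventually_ne) (use d in auto)
  then have "\<forall>\<^sub>F s in at t. f s \<noteq> 0"
    by eventually_elim (auto simp: ft)
  then obtain V where "open V" "t \<in> V" "\<forall>s\<in>V. s \<noteq> t \<longrightarrow> f s \<noteq> 0"
    unfolding eventually_at_topological by blast
  then show "\<exists>V. open V \<and> t \<in> V \<and> V \<inter> ?X \<subseteq> {t}" by (intro exI[of _ V]) blast
qed

text \<open>A time at which the velocity is transverse to a stratum is a transversal zero of some \<open>y\<^sub>j\<close>. This
makes lengths independent of the values of the metric on transverse vectors.\<close>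

lemma AE_velocity_stratum_tangent:
  fixes \<gamma> :: "real \<Rightarrow> ('m::finite, 'n::finite) space"
  assumes "\<forall>t\<in>T. (\<gamma> has_vector_derivative D t) (at t)"
  shows "AE t in lborel. t \<in> T \<longrightarrow> (\<forall>j. snd (\<gamma> t) $ j = 0 \<longrightarrow> snd (D t) $ j = 0)"
proof -
  define N where "N = (\<Union>j. {t. snd (\<gamma> t) $ j = 0 \<and>
    (\<exists>d. d \<noteq> 0 \<and> ((\<lambda>t. snd (\<gamma> t) $ j) has_vector_derivative d) (at t))})"
  have "countable N"
    unfolding N_def by (intro countable_UN countable_transversal_zeros) auto
  then have "AE t in lborel. t \<notin> N"
    by (intro AE_not_in countable_imp_null_set_lborel)
  then show ?thesis
  proof eventually_elim
    case (elim t)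
    show ?case
    proof (intro impI allI, rule ccontr)
      fix j assume t: "t \<in> T" and z: "snd (\<gamma> t) $ j = 0" and nz: "snd (D t) $ j \<noteq> 0"
      have "((\<lambda>t. snd (\<gamma> t) $ j) has_vector_derivative snd (D t) $ j) (at t)"
        by (rule bounded_linear.has_vector_derivative[OF bounded_linear_vec_nth])
          (rule bounded_linear.has_vector_derivative[OF bounded_linear_snd bspec[OF assms t]])
      then show False using z nz elim by (auto simp: N_def)
    qed
  qed
qed

section \<open>Lengths as integrals without measurability\<close>

text \<open>The integrand of \<open>curve_length\<close> involves values of the metric about which nothing is known, so
measurability is not at hand. The integral of an arbitrary nonnegative function is its lower
integral, and that is still additive in the domain: a simple function below the whole restricts to
the parts, and simple functions below disjoint parts add up to one below the whole.\<close>

lemma nn_integral_indicator_Un: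
  fixes f :: "'a \<Rightarrow> ennreal"
  assumes A: "A \<in> sets M" and B: "B \<in> sets M" and AB: "A \<inter> B = {}"
  shows "(\<integral>\<^sup>+x. f x * indicator (A \<union> B) x \<partial>M)
    = (\<integral>\<^sup>+x. f x * indicator A x \<partial>M) + (\<integral>\<^sup>+x. f x * indicator B x \<partial>M)"
    (is "?L = ?a + ?b")
proof (rule antisym)
  show "?L \<le> ?a + ?b"
    unfolding nn_integral_def[of M "\<lambda>x. f x * indicator (A \<union> B) x"]
  proof (intro SUP_least, safe)
    fix s assume s: "simple_function M s" "s \<le> (\<lambda>x. f x * indicator (A \<union> B) x)"
    have ms: "s \<in> borel_measurable M" using s(1) by (rule borel_measurable_simple_function)
    have le: "s x \<le> f x * indicator (A \<union> B) x" for x using s(2) by (simp add: le_fun_def)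
    have eq: "s x = s x * indicator A x + s x * indicator B x" for x
      using le[of x] AB by (auto split: split_indicator)
    have "integral\<^sup>S M s = (\<integral>\<^sup>+x. s x \<partial>M)" using s(1) by (simp add: nn_integral_eq_simple_integral)
    also have "\<dots> = (\<integral>\<^sup>+x. s x * indicator A x + s x * indicator B x \<partial>M)"
      using eq by simp
    also have "\<dots> = (\<integral>\<^sup>+x. s x * indicator A x \<partial>M) + (\<integral>\<^sup>+x. s x * indicator B x \<partial>M)"
      using A B ms by (intro nn_integral_add) auto
    also have "\<dots> \<le> ?a + ?b"
    proof (intro add_mono nn_integral_mono)
      show "s x * indicator A x \<le> f x * indicator A x" for x
        using le[of x] by (auto split: split_indicator)
      show "s x * indicator B x \<le> f x * indicator B x" for x
        using le[of x] by (auto split: split_indicator)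
    qed
    finally show "integral\<^sup>S M s \<le> ?a + ?b" .
  qed
  define S where "S C = {s. simple_function M s \<and> s \<le> (\<lambda>x. f x * indicator C x)}" for C
  have ne: "S C \<noteq> {}" for C
    by (auto simp: S_def le_fun_def intro!: exI[of _ "\<lambda>_. 0"])
  have step: "integral\<^sup>S M s + integral\<^sup>S M u \<le> ?L" if "s \<in> S A" "u \<in> S B" for s u
  proof -
    have "s x + u x \<le> f x * indicator (A \<union> B) x" for x
    proof -
      have "s x \<le> f x * indicator A x" "u x \<le> f x * indicator B x"
        using that by (auto simp: S_def le_fun_def)
      then show ?thesis using AB by (auto split: split_indicator_asm split_indicator)
    qed
    moreover have "simple_function M (\<lambda>x. s x + u x)" using that by (auto simp: S_def)
    ultimately have "integral\<^sup>S M (\<lambda>x. s x + u x) \<le> ?L"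
      unfolding nn_integral_def by (intro SUP_upper) (auto simp: le_fun_def)
    then show ?thesis using that by (simp add: S_def simple_integral_add)
  qed
  have "?a + ?b = (SUP s\<in>S A. integral\<^sup>S M s + ?b)"
    unfolding ennreal_SUP_add_left[OF ne] by (simp add: nn_integral_def S_def)
  also have "\<dots> \<le> ?L"
  proof (rule SUP_least)
    fix s assume s: "s \<in> S A"
    have "integral\<^sup>S M s + ?b = (SUP u\<in>S B. integral\<^sup>S M u + integral\<^sup>S M s)"
      unfolding ennreal_SUP_add_left[OF ne] by (simp add: nn_integral_def S_def add.commute)
    also have "\<dots> \<le> ?L" using step[OF s] by (intro SUP_least) (simp add: add.commute)
    finally show "integral\<^sup>S M s + ?b \<le> ?L" .
  qed
  finally show "?a + ?b \<le> ?L" .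
qed

lemma AE_Icc_mono:
  fixes f g :: "real \<Rightarrow> ennreal"
  assumes "AE t in lborel. t \<in> {p<..<q} \<longrightarrow> f t \<le> g t"
  shows "(\<integral>\<^sup>+t\<in>{p..q}. f t \<partial>lborel) \<le> (\<integral>\<^sup>+t\<in>{p..q}. g t \<partial>lborel)"
  using assms AE_lborel_singleton[of p] AE_lborel_singleton[of q]
  by (intro nn_integral_mono_AE, eventually_elim) (auto split: split_indicator)

lemma nn_integral_Icc_combine:
  fixes f :: "real \<Rightarrow> ennreal"
  assumes "p \<le> q" "q \<le> s"
  shows "(\<integral>\<^sup>+t\<in>{p..s}. f t \<partial>lborel) = (\<integral>\<^sup>+t\<in>{p..q}. f t \<partial>lborel) + (\<integral>\<^sup>+t\<in>{q..s}. f t \<partial>lborel)"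
proof -
  have "(\<integral>\<^sup>+t\<in>{q<..s}. f t \<partial>lborel) = (\<integral>\<^sup>+t\<in>{q..s}. f t \<partial>lborel)"
    using AE_lborel_singleton[of q]
    by (intro nn_integral_cong_AE, eventually_elim) (auto split: split_indicator)
  moreover have "{p..s} = {p..q} \<union> {q<..s}" using assms by auto
  ultimately show ?thesis
    using nn_integral_indicator_Un[of "{p..q}" lborel "{q<..s}" f] by (simp add: ivl_disj_int)
qed

text \<open>The derivative \<open>F\<close> may change sign and be unbounded near the ends, so it need not be integrable in the
sense of Lebesgue. On a compact subinterval it is continuous and the bound is the fundamental
theorem; continuity of \<open>P\<close> then exhausts the interval.\<close>

lemma increment_le_nn_integral:
  fixes P F f :: "real \<Rightarrow> real"
  assumes pc: "p < c" and contP: "continuous_on {p..c} P"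
    and der: "\<And>t. p < t \<Longrightarrow> t < c \<Longrightarrow> (P has_real_derivative F t) (at t)"
    and contF: "continuous_on {p<..<c} F"
    and le: "AE t in lborel. t \<in> {p<..<c} \<longrightarrow> F t \<le> f t"
  shows "ennreal (P c - P p) \<le> (\<integral>\<^sup>+t\<in>{p..c}. ennreal (f t) \<partial>lborel)" (is "_ \<le> ?I")
proof (cases ?I)
  case (real i)
  have step: "P s - P q \<le> i" if "p < q" "q < s" "s < c" for q s
  proof -
    have cF: "continuous_on {q..s} F" using that by (intro continuous_on_subset[OF contF]) auto
    have F: "(F has_integral P s - P q) {q..s}"
      using that contP by (intro fundamental_theorem_of_calculus_interior)
        (auto intro!: der continuous_on_subset[OF contP] simp: has_real_derivative_iff_has_vector_derivative[symmetric])
    have "continuous_on {q..s} (\<lambda>t. max 0 (F t))" using cF by (intro continuous_intros)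
    then obtain J where J: "((\<lambda>t. max 0 (F t)) has_integral J) {q..s}"
      using integrable_continuous_real integrable_on_def by blast
    have "P s - P q \<le> J" by (rule has_integral_le[OF F J]) auto
    then have "ennreal (P s - P q) \<le> ennreal J" by (rule ennreal_leI)
    also have "\<dots> = (\<integral>\<^sup>+t\<in>{q..s}. ennreal (max 0 (F t)) \<partial>lborel)"
      by (rule nn_integral_has_integral_lebesgue'[OF _ J, symmetric]) auto
    also have "\<dots> \<le> ?I"
      using le that
      by (intro nn_integral_mono_AE, elim eventually_mono)
        (auto split: split_indicator simp: max_def intro: ennreal_leI)
    finally have "ennreal (P s - P q) \<le> ?I" .
    then show ?thesis unfolding real(2) using real(1) by simp
  qed
  have "P c - P q \<le> i" if "p < q" "q < c" for q
  proof (rule tendsto_upperbound)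
    show "((\<lambda>s. P s - P q) \<longlongrightarrow> P c - P q) (at_left c)"
      using continuous_on_Icc_at_leftD[OF contP pc] by (intro tendsto_intros)
    show "\<forall>\<^sub>F s in at_left c. P s - P q \<le> i"
      using eventually_at_left_real[OF \<open>q < c\<close>] by eventually_elim (use step that in auto)
  qed auto
  note step2 = this
  have "P c - P p \<le> i"
  proof (rule tendsto_upperbound)
    show "((\<lambda>q. P c - P q) \<longlongrightarrow> P c - P p) (at_right p)"
      using continuous_on_Icc_at_rightD[OF contP pc] by (intro tendsto_intros)
    show "\<forall>\<^sub>F q in at_right p. P c - P q \<le> i"
      using eventually_at_right_real[OF pc] by eventually_elim (use step2 in auto)
  qed auto
  then show ?thesis
    unfolding real(2) by (rule ennreal_leI)
qed auto

lemma vector_derivative_cong_open: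
  assumes "open S" "t \<in> S" "\<And>s. s \<in> S \<Longrightarrow> f s = h s"
  shows "vector_derivative f (at t) = vector_derivative h (at t)"
proof -
  have "(f has_vector_derivative d) (at t) \<longleftrightarrow> (h has_vector_derivative d) (at t)" for d
    using assms has_vector_derivative_transform_within_open[of f d t S h]
      has_vector_derivative_transform_within_open[of h d t S f] by metis
  then show ?thesis by (simp add: vector_derivative_def)
qed

lemma curve_length_cong:
  assumes "\<And>t. t \<in> {p<..<q} \<Longrightarrow> \<delta> t = \<gamma> t"
  shows "curve_length g p q \<delta> = curve_length g p q \<gamma>"
proof -
  have "vector_derivative \<delta> (at t) = vector_derivative \<gamma> (at t)" if "t \<in> {p<..<q}" for t
    using assms that by (intro vector_derivative_cong_open[of "{p<..<q}"]) auto
  then show ?thesis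
    unfolding curve_length_def using assms
    by (intro antisym AE_Icc_mono) auto
qed

lemma curve_length_combine:
  "p \<le> q \<Longrightarrow> q \<le> s \<Longrightarrow> curve_length g p s \<gamma> = curve_length g p q \<gamma> + curve_length g q s \<gamma>"
  unfolding curve_length_def by (rule nn_integral_Icc_combine)

lemma curve_length_on_axes:
  fixes \<gamma> :: "real \<Rightarrow> ('m::finite, 'n::finite) space"
  assumes der: "\<And>t. t \<in> {p<..<q} \<Longrightarrow> (\<gamma> has_vector_derivative (u t, 0)) (at t)"
    and axes: "\<And>t. t \<in> {p<..<q} \<Longrightarrow> snd (\<gamma> t) = 0"
    and v: "\<And>t. t \<in> {p<..<q} \<Longrightarrow> v t = sqrt (axes_metric g (fst (\<gamma> t)) (u t) (u t))"
    and v0: "\<And>t. t \<in> {p..q} \<Longrightarrow> 0 \<le> v t"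
    and I: "(v has_integral I) {p..q}"
  shows "curve_length g p q \<gamma> = ennreal I"
proof -
  have "sqrt (g (\<gamma> t) (vector_derivative \<gamma> (at t)) (vector_derivative \<gamma> (at t))) = v t"
    if t: "t \<in> {p<..<q}" for t
  proof -
    have "\<gamma> t = (fst (\<gamma> t), 0)" using axes[OF t] by (metis prod.collapse)
    then show ?thesis
      using vector_derivative_at[OF der[OF t]] v[OF t] by (metis axes_metric_def)
  qed
  then have "curve_length g p q \<gamma> = (\<integral>\<^sup>+t\<in>{p..q}. ennreal (v t) \<partial>lborel)"
    unfolding curve_length_def by (intro antisym AE_Icc_mono) auto
  also have "\<dots> = ennreal I" by (rule nn_integral_has_integral_lebesgue'[OF v0 I])
  finally show ?thesis .
qed

section \<open>Families of quadratic forms\<close>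

lemma continuous_on_bilinear_form:
  fixes G :: "'b::topological_space \<Rightarrow> 'a::euclidean_space \<Rightarrow> 'a \<Rightarrow> real" and x :: "'c::topological_space \<Rightarrow> 'b"
  assumes bil: "\<And>p. p \<in> S \<Longrightarrow> bilinear (G p)"
    and cont: "\<And>v w. continuous_on S (\<lambda>p. G p v w)"
    and x: "continuous_on T x" "x ` T \<subseteq> S" and u: "continuous_on T u"
  shows "continuous_on T (\<lambda>t. G (x t) (u t) (u t))"
proof -
  have "G (x t) (u t) (u t) = (\<Sum>(i,j)\<in>Basis \<times> Basis. (u t \<bullet> i) * (u t \<bullet> j) * G (x t) i j)" if "t \<in> T" for t
  proof -
    have b: "bilinear (G (x t))" using that bil x(2) by blast
    have "G (x t) (u t) (u t) = G (x t) (\<Sum>i\<in>Basis. (u t \<bullet> i) *\<^sub>R i) (\<Sum>i\<in>Basis. (u t \<bullet> i) *\<^sub>R i)"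
      by (simp only: euclidean_representation)
    also have "\<dots> = (\<Sum>(i,j)\<in>Basis \<times> Basis. (u t \<bullet> i) * (u t \<bullet> j) * G (x t) i j)"
      unfolding bilinear_sum[OF b]
      by (intro sum.cong) (auto simp: bilinear_lmul[OF b] bilinear_rmul[OF b])
    finally show ?thesis .
  qed
  moreover have "continuous_on T (\<lambda>t. \<Sum>(i,j)\<in>Basis \<times> Basis. (u t \<bullet> i) * (u t \<bullet> j) * G (x t) i j)"
    using continuous_on_compose2[OF cont x(1) x(2)] u
    by (auto simp: case_prod_unfold intro!: continuous_intros)
  ultimately show ?thesis by (simp cong: continuous_on_cong)
qed

text \<open>By homogeneity it suffices to bound the form on \<open>K\<close> times the unit sphere, which is compact.\<close>

lemma bilinear_form_bounded_on_compact:
  fixes G :: "'b::topological_space \<Rightarrow> 'a::euclidean_space \<Rightarrow> 'a \<Rightarrow> real"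
  assumes bil: "\<And>p. p \<in> S \<Longrightarrow> bilinear (G p)"
    and cont: "\<And>v w. continuous_on S (\<lambda>p. G p v w)"
    and K: "compact K" "K \<subseteq> S"
  obtains M where "M \<ge> 0" "\<And>p u. p \<in> K \<Longrightarrow> G p u u \<le> M * (norm u)\<^sup>2"
proof -
  have "continuous_on (K \<times> sphere 0 1) (\<lambda>q. G (fst q) (snd q) (snd q))"
    using K by (intro continuous_on_bilinear_form[OF bil cont]) (auto intro!: continuous_intros)
  then have "compact ((\<lambda>q. G (fst q) (snd q) (snd q)) ` (K \<times> sphere 0 1))"
    using K by (intro compact_continuous_image compact_Times) auto
  from compact_imp_bounded[OF this]
  obtain M where M: "\<And>q. q \<in> K \<times> sphere 0 1 \<Longrightarrow> \<bar>G (fst q) (snd q) (snd q)\<bar> \<le> M"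
    unfolding bounded_iff real_norm_def by blast
  show ?thesis
  proof (rule that[of "max M 0"])
    fix p u assume p: "p \<in> K"
    have b: "bilinear (G p)" using p K bil by blast
    show "G p u u \<le> max M 0 * (norm u)\<^sup>2"
    proof (cases "u = 0")
      case True then show ?thesis using b by (simp add: bilinear_lzero)
    next
      case False
      define e where "e = u /\<^sub>R norm u"
      have u: "u = norm u *\<^sub>R e" and "e \<in> sphere 0 1" using False by (auto simp: e_def)
      then have "\<bar>G p e e\<bar> \<le> M" using M[of "(p, e)"] p by simp
      then have "G p e e * (norm u)\<^sup>2 \<le> max M 0 * (norm u)\<^sup>2" by (intro mult_right_mono) auto
      moreover have "G p u u = G p e e * (norm u)\<^sup>2"
      proof -
        have "G p u u = G p (norm u *\<^sub>R e) (norm u *\<^sub>R e)" using arg_cong2[OF u u, of "G p"] .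
        then show ?thesis by (simp add: bilinear_lmul[OF b] bilinear_rmul[OF b] power2_eq_square)
      qed
      ultimately show ?thesis by simp
    qed
  qed simp
qed

section \<open>Length estimates\<close>

context cuspidal_estimates
begin

lemma proj_U: "q \<in> U \<Longrightarrow> (fst q, 0) \<in> U"
  using axes_U[of "fst q" "snd q"] by simp

lemma axes_bilinear: "(x, 0) \<in> U \<Longrightarrow> bilinear (axes_metric g x)"
  using riem by (auto simp: smooth_riemannian_metric_on_def symmetric_bilinear_def)

lemma axes_pos: "(x, 0) \<in> U \<Longrightarrow> u \<noteq> 0 \<Longrightarrow> axes_metric g x u u > 0"
  using riem by (auto simp: smooth_riemannian_metric_on_def)

lemma axes_nonneg: "(x, 0) \<in> U \<Longrightarrow> axes_metric g x u u \<ge> 0"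
  using axes_pos[of x u] axes_bilinear[of x] by (cases "u = 0") (auto simp: bilinear_lzero)

lemma axes_continuous: "continuous_on {x. (x, 0) \<in> U} (\<lambda>x. axes_metric g x v w)"
proof -
  have "Ck_on 0 {x. (x, 0) \<in> U} (\<lambda>x. axes_metric g x v w)"
    using riem unfolding smooth_riemannian_metric_on_def smooth_on_def by blast
  then show ?thesis by simp
qed

lemma axes_speed_continuous:
  assumes "continuous_on T x" "\<And>t. t \<in> T \<Longrightarrow> (x t, 0) \<in> U" "continuous_on T u"
  shows "continuous_on T (\<lambda>t. sqrt (axes_metric g (x t) (u t) (u t)))"
  using assms axes_bilinear axes_continuous
  by (intro continuous_intros continuous_on_bilinear_form[of "{x. (x, 0) \<in> U}" "axes_metric g" T x u]) auto

lemma AE_speed_le: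
  assumes der: "\<forall>t\<in>{p<..<q}. (\<gamma> has_vector_derivative D t) (at t)"
    and inU: "\<forall>t\<in>{p<..<q}. \<gamma> t \<in> U"
  shows "AE t in lborel. t \<in> {p<..<q} \<longrightarrow>
    g (\<gamma> t) (vector_derivative \<gamma> (at t)) (vector_derivative \<gamma> (at t))
    \<le> (1 + C * (norm (snd (\<gamma> t)))\<^sup>2) * (axes_metric g (fst (\<gamma> t)) (fst (D t)) (fst (D t))
         + (4 + (norm (snd (\<gamma> t))) ^ 4) * (norm (snd (D t)))\<^sup>2)"
  using AE_velocity_stratum_tangent[of "{p<..<q}" \<gamma> D, OF der]
proof eventually_elim
  case (elim t)
  show ?case
  proof
    assume t: "t \<in> {p<..<q}"
    have vd: "vector_derivative \<gamma> (at t) = D t" by (rule vector_derivative_at[OF bspec[OF der t]])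
    have "(fst (\<gamma> t), snd (\<gamma> t)) \<in> U" using bspec[OF inU t] by simp
    from upper[OF this, of "snd (D t)" "fst (D t)"] elim t
    show "g (\<gamma> t) (vector_derivative \<gamma> (at t)) (vector_derivative \<gamma> (at t))
    \<le> (1 + C * (norm (snd (\<gamma> t)))\<^sup>2) * (axes_metric g (fst (\<gamma> t)) (fst (D t)) (fst (D t))
         + (4 + (norm (snd (\<gamma> t))) ^ 4) * (norm (snd (D t)))\<^sup>2)"
      by (simp add: vd)
  qed
qed

lemma AE_speed_ge:
  assumes der: "\<forall>t\<in>{p<..<q}. (\<gamma> has_vector_derivative D t) (at t)"
    and inU: "\<forall>t\<in>{p<..<q}. \<gamma> t \<in> U"
    and small: "\<forall>t\<in>{p<..<q}. norm (snd (\<gamma> t)) \<le> r" and r: "C * r\<^sup>2 \<le> 1"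
  shows "AE t in lborel. t \<in> {p<..<q} \<longrightarrow>
    (1 - C * r\<^sup>2) * (axes_metric g (fst (\<gamma> t)) (fst (D t)) (fst (D t))
         + 4 * ((snd (\<gamma> t) \<bullet> snd (D t)) / norm (snd (\<gamma> t)))\<^sup>2)
    \<le> g (\<gamma> t) (vector_derivative \<gamma> (at t)) (vector_derivative \<gamma> (at t))"
  using AE_velocity_stratum_tangent[of "{p<..<q}" \<gamma> D, OF der]
proof eventually_elim
  case (elim t)
  show ?case
  proof
    assume t: "t \<in> {p<..<q}"
    have vd: "vector_derivative \<gamma> (at t) = D t" by (rule vector_derivative_at[OF bspec[OF der t]])
    have U: "(fst (\<gamma> t), snd (\<gamma> t)) \<in> U" using bspec[OF inU t] by simp
    let ?Q = "axes_metric g (fst (\<gamma> t)) (fst (D t)) (fst (D t))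
         + 4 * ((snd (\<gamma> t) \<bullet> snd (D t)) / norm (snd (\<gamma> t)))\<^sup>2"
    have Q: "?Q \<ge> 0" using axes_nonneg[OF axes_U[OF U]] by (intro add_nonneg_nonneg) auto
    have le: "C * (norm (snd (\<gamma> t)))\<^sup>2 \<le> C * r\<^sup>2"
      using bspec[OF small t] C_nonneg by (intro mult_left_mono power_mono) auto
    have "(1 - C * r\<^sup>2) * ?Q \<le> (1 - C * (norm (snd (\<gamma> t)))\<^sup>2) * ?Q"
      using le Q by (intro mult_right_mono) auto
    also have "\<dots> \<le> g (\<gamma> t) (D t) (D t)"
      using lower[OF U, of "snd (D t)" "fst (D t)"] elim t le r by simp
    finally show "(1 - C * r\<^sup>2) * ?Q
       \<le> g (\<gamma> t) (vector_derivative \<gamma> (at t)) (vector_derivative \<gamma> (at t))"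
      by (simp add: vd)
  qed
qed

text \<open>The upper bound of the locale is at most a constant multiple of the squared velocity as long as the curve
stays in a compact set, in spite of the singular directions of the metric.\<close>

lemma curve_length_finite:
  assumes cont: "continuous_on {p..q} \<gamma>" and inU: "\<gamma> ` {p..q} \<subseteq> U"
    and der: "\<And>t. t \<in> {p<..<q} \<Longrightarrow> (\<gamma> has_vector_derivative D t) (at t)"
    and bdd: "\<And>t. t \<in> {p<..<q} \<Longrightarrow> norm (D t) \<le> B"
  shows "curve_length g p q \<gamma> < \<infinity>"
proof -
  define K where "K = (\<lambda>t. fst (\<gamma> t)) ` {p..q}"
  have "compact K" unfolding K_def using cont
    by (intro compact_continuous_image continuous_intros) auto
  moreover have "K \<subseteq> {x. (x, 0) \<in> U}"
    using inU unfolding K_def by (auto intro!: proj_U)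
  ultimately obtain M where M: "M \<ge> 0" "\<And>x u. x \<in> K \<Longrightarrow> axes_metric g x u u \<le> M * (norm u)\<^sup>2"
    using bilinear_form_bounded_on_compact[of "{x. (x, 0) \<in> U}" "axes_metric g" K] axes_bilinear axes_continuous
    by blast
  have "compact ((\<lambda>t. snd (\<gamma> t)) ` {p..q})"
    using cont by (intro compact_continuous_image continuous_intros) auto
  from compact_imp_bounded[OF this] obtain R where R: "\<And>t. t \<in> {p..q} \<Longrightarrow> norm (snd (\<gamma> t)) \<le> R"
    unfolding bounded_iff by blast
  have B1: "\<forall>t\<in>{p<..<q}. (\<gamma> has_vector_derivative D t) (at t)" using der by blast
  have B2: "\<forall>t\<in>{p<..<q}. \<gamma> t \<in> U" using inU by auto
  define Z where "Z = (1 + C * R\<^sup>2) * (M * B\<^sup>2 + (4 + R ^ 4) * B\<^sup>2)"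
  have "AE t in lborel. t \<in> {p<..<q} \<longrightarrow>
     ennreal (sqrt (g (\<gamma> t) (vector_derivative \<gamma> (at t)) (vector_derivative \<gamma> (at t)))) \<le> ennreal (sqrt Z)"
    using AE_speed_le[OF B1 B2]
  proof (eventually_elim, safe)
    fix t assume t: "t \<in> {p<..<q}"
      and le: "g (\<gamma> t) (vector_derivative \<gamma> (at t)) (vector_derivative \<gamma> (at t))
        \<le> (1 + C * (norm (snd (\<gamma> t)))\<^sup>2) * (axes_metric g (fst (\<gamma> t)) (fst (D t)) (fst (D t))
         + (4 + (norm (snd (\<gamma> t))) ^ 4) * (norm (snd (D t)))\<^sup>2)"
    have t': "t \<in> {p..q}" using t by auto
    have n1: "norm (fst (D t)) \<le> B" "norm (snd (D t)) \<le> B"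
      using bdd[OF t] norm_fst_le[of "fst (D t)" "snd (D t)"] norm_snd_le[of "snd (D t)" "fst (D t)"] by auto
    have "axes_metric g (fst (\<gamma> t)) (fst (D t)) (fst (D t)) \<le> M * (norm (fst (D t)))\<^sup>2"
      using t' by (intro M) (auto simp: K_def)
    also have "\<dots> \<le> M * B\<^sup>2" using M n1 by (intro mult_left_mono power_mono) auto
    finally have a: "axes_metric g (fst (\<gamma> t)) (fst (D t)) (fst (D t)) \<le> M * B\<^sup>2" .
    have b: "(4 + (norm (snd (\<gamma> t))) ^ 4) * (norm (snd (D t)))\<^sup>2 \<le> (4 + R ^ 4) * B\<^sup>2"
      using n1 R[OF t'] by (intro mult_mono add_left_mono power_mono) auto
    have "(1 + C * (norm (snd (\<gamma> t)))\<^sup>2) * (axes_metric g (fst (\<gamma> t)) (fst (D t)) (fst (D t))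
         + (4 + (norm (snd (\<gamma> t))) ^ 4) * (norm (snd (D t)))\<^sup>2)
       \<le> (1 + C * (norm (snd (\<gamma> t)))\<^sup>2) * (M * B\<^sup>2 + (4 + R ^ 4) * B\<^sup>2)"
      using a b C_nonneg by (intro mult_left_mono) auto
    also have "\<dots> \<le> Z"
      unfolding Z_def using R[OF t'] C_nonneg M
      by (intro mult_right_mono add_left_mono mult_left_mono power_mono) auto
    finally show "ennreal (sqrt (g (\<gamma> t) (vector_derivative \<gamma> (at t)) (vector_derivative \<gamma> (at t)))) \<le> ennreal (sqrt Z)"
      using le by (intro ennreal_leI real_sqrt_le_mono) linarith
  qed
  then have "curve_length g p q \<gamma> \<le> (\<integral>\<^sup>+t\<in>{p..q}. ennreal (sqrt Z) \<partial>lborel)"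
    unfolding curve_length_def by (rule AE_Icc_mono)
  also have "\<dots> < \<infinity>"
    by (simp add: nn_integral_cmult_indicator ennreal_mult_less_top emeasure_lborel_Icc_eq)
  finally show ?thesis .
qed

text \<open>The number \<open>w\<close> bounds the extra speed caused by vertical motion: the hypothesis on \<open>w\<close> makes
\<open>v\<^sup>2 + 5 z\<^sup>2 \<le> v\<^sup>2 + 2 w v \<le> (v + w)\<^sup>2\<close> for a vertical velocity of norm \<open>z\<close>. A frozen \<open>y\<close> permits
\<open>w = 0\<close> even where the horizontal speed vanishes; for a moving \<open>y\<close> the horizontal speed has to be
bounded below. The factor \<open>1 + C r\<^sup>2\<close> is at least \<open>1\<close> and therefore bounds its own square root.\<close>

lemma curve_length_le:
  assumes der: "\<And>t. t \<in> {p<..<q} \<Longrightarrow> (\<gamma> has_vector_derivative D t) (at t)"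
    and inU: "\<And>t. t \<in> {p<..<q} \<Longrightarrow> \<gamma> t \<in> U"
    and small: "\<And>t. t \<in> {p<..<q} \<Longrightarrow> norm (snd (\<gamma> t)) \<le> r" and r: "r \<le> 1"
    and v: "\<And>t. t \<in> {p<..<q} \<Longrightarrow> v t = sqrt (axes_metric g (fst (\<gamma> t)) (fst (D t)) (fst (D t)))"
    and v0: "\<And>t. t \<in> {p..q} \<Longrightarrow> 0 \<le> v t"
    and vert: "\<And>t. t \<in> {p<..<q} \<Longrightarrow> 5 * (norm (snd (D t)))\<^sup>2 \<le> 2 * w * v t" and w: "w \<ge> 0"
    and I: "(v has_integral I) {p..q}" and pq: "p \<le> q"
  shows "curve_length g p q \<gamma> \<le> ennreal ((1 + C * r\<^sup>2) * (I + w * (q - p)))"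
proof -
  have B1: "\<forall>t\<in>{p<..<q}. (\<gamma> has_vector_derivative D t) (at t)" using der by blast
  have B2: "\<forall>t\<in>{p<..<q}. \<gamma> t \<in> U" using inU by auto
  define k where "k = 1 + C * r\<^sup>2"
  have k1: "k \<ge> 1" using C_nonneg by (simp add: k_def)
  have "AE t in lborel. t \<in> {p<..<q} \<longrightarrow>
     ennreal (sqrt (g (\<gamma> t) (vector_derivative \<gamma> (at t)) (vector_derivative \<gamma> (at t)))) \<le> ennreal (k * (v t + w))"
    using AE_speed_le[OF B1 B2]
  proof (eventually_elim, safe)
    fix t assume t: "t \<in> {p<..<q}"
      and le: "g (\<gamma> t) (vector_derivative \<gamma> (at t)) (vector_derivative \<gamma> (at t))
        \<le> (1 + C * (norm (snd (\<gamma> t)))\<^sup>2) * (axes_metric g (fst (\<gamma> t)) (fst (D t)) (fst (D t))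
         + (4 + (norm (snd (\<gamma> t))) ^ 4) * (norm (snd (D t)))\<^sup>2)"
    have vv: "axes_metric g (fst (\<gamma> t)) (fst (D t)) (fst (D t)) = (v t)\<^sup>2"
      using axes_nonneg[OF proj_U[OF inU[OF t]]] v[OF t] by simp
    have vt: "v t \<ge> 0" using v0 t by auto
    have y1: "norm (snd (\<gamma> t)) ^ 4 \<le> 1" using small[OF t] r by (intro power_le_one) auto
    have "(4 + (norm (snd (\<gamma> t))) ^ 4) * (norm (snd (D t)))\<^sup>2 \<le> 5 * (norm (snd (D t)))\<^sup>2"
      using y1 by (intro mult_right_mono) auto
    also have "\<dots> \<le> 2 * w * v t" by (rule vert[OF t])
    also have "(v t)\<^sup>2 + 2 * w * v t \<le> (v t + w)\<^sup>2" by (simp add: power2_sum)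
    finally have q1: "axes_metric g (fst (\<gamma> t)) (fst (D t)) (fst (D t)) + (4 + (norm (snd (\<gamma> t))) ^ 4) * (norm (snd (D t)))\<^sup>2
       \<le> (v t + w)\<^sup>2" unfolding vv by simp
    have "C * (norm (snd (\<gamma> t)))\<^sup>2 \<le> C * r\<^sup>2"
      using small[OF t] C_nonneg by (intro mult_left_mono power_mono) auto
    then have k2: "1 + C * (norm (snd (\<gamma> t)))\<^sup>2 \<le> k" by (simp add: k_def)
    note le
    also have "(1 + C * (norm (snd (\<gamma> t)))\<^sup>2) * (axes_metric g (fst (\<gamma> t)) (fst (D t)) (fst (D t))
         + (4 + (norm (snd (\<gamma> t))) ^ 4) * (norm (snd (D t)))\<^sup>2) \<le> k * (v t + w)\<^sup>2"
      using q1 k2 k1 by (intro mult_mono) (auto simp: vv)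
    also have "\<dots> \<le> k\<^sup>2 * (v t + w)\<^sup>2"
      using k1 by (intro mult_right_mono) (auto simp: power2_eq_square)
    finally show "ennreal (sqrt (g (\<gamma> t) (vector_derivative \<gamma> (at t)) (vector_derivative \<gamma> (at t)))) \<le> ennreal (k * (v t + w))"
      using k1 vt w by (intro ennreal_leI real_le_lsqrt) (auto simp: power_mult_distrib)
  qed
  then have "curve_length g p q \<gamma> \<le> (\<integral>\<^sup>+t\<in>{p..q}. ennreal (k * (v t + w)) \<partial>lborel)"
    unfolding curve_length_def by (rule AE_Icc_mono)
  also have "\<dots> = ennreal (k * (I + w * (q - p)))"
  proof (rule nn_integral_has_integral_lebesgue')
    show "0 \<le> k * (v t + w)" if "t \<in> {p..q}" for t using v0[OF that] k1 w by auto
    have "((\<lambda>t. w) has_integral (q - p) *\<^sub>R w) {p..q}" using has_integral_const_real[of w p q] pq by simp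
    then show "((\<lambda>t. k * (v t + w)) has_integral k * (I + w * (q - p))) {p..q}"
      using I by (intro has_integral_mult_right has_integral_add) (auto simp: mult.commute)
  qed
  finally show ?thesis by (simp add: k_def)
qed

text \<open>In the product of the axes with a half line, a curve with horizontal length \<open>l\<close> whose height drops from
\<open>2 r\<close> to \<open>0\<close> is at least as long as the hypotenuse; the cuspidal metric costs the factor \<open>1 - C r\<^sup>2\<close>. Minkowski's inequality for integrals appears in
the linear form: the speed dominates the component of (horizontal speed, minus twice the derivative of
\<open>norm y\<close>) in a fixed unit direction, and the integral of that component is explicit. Only the
endpoint values of \<open>norm y\<close> enter, so its derivative may be unbounded near \<open>c\<close>.\<close>

lemma curve_length_ge:
  assumes pc: "p < c" and cont: "continuous_on {p..c} \<gamma>"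
    and der: "\<And>t. t \<in> {p<..<c} \<Longrightarrow> (\<gamma> has_vector_derivative D t) (at t)"
    and contD: "continuous_on {p<..<c} D"
    and inU: "\<And>t. t \<in> {p<..<c} \<Longrightarrow> \<gamma> t \<in> U"
    and small: "\<And>t. t \<in> {p<..<c} \<Longrightarrow> norm (snd (\<gamma> t)) \<le> r" and r: "C * r\<^sup>2 \<le> 1"
    and off: "\<And>t. t \<in> {p<..<c} \<Longrightarrow> snd (\<gamma> t) \<noteq> 0"
    and ends: "norm (snd (\<gamma> p)) = r" "snd (\<gamma> c) = 0" "0 < r"
    and v: "\<And>t. t \<in> {p<..<c} \<Longrightarrow> v t = sqrt (axes_metric g (fst (\<gamma> t)) (fst (D t)) (fst (D t)))"
    and l: "(v has_integral l) {p..c}"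
  shows "ennreal ((1 - C * r\<^sup>2) * sqrt (l\<^sup>2 + 4 * r\<^sup>2)) \<le> curve_length g p c \<gamma>"
proof -
  have B1: "\<forall>t\<in>{p<..<c}. (\<gamma> has_vector_derivative D t) (at t)" using der by blast
  have B2: "\<forall>t\<in>{p<..<c}. \<gamma> t \<in> U" using inU by blast
  have B3: "\<forall>t\<in>{p<..<c}. norm (snd (\<gamma> t)) \<le> r" using small by blast
  define k where "k = 1 - C * r\<^sup>2"
  have k: "0 \<le> k" "k \<le> 1" using r C_nonneg by (auto simp: k_def)
  define d where "d = sqrt (l\<^sup>2 + 4 * r\<^sup>2)"
  have d0: "d > 0" unfolding d_def using ends(3) by (intro real_sqrt_gt_zero add_nonneg_pos) auto
  have d2: "d\<^sup>2 = l\<^sup>2 + 4 * r\<^sup>2" unfolding d_def by simp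
  \<comment> \<open>\<open>(\<alpha>, \<beta>)\<close> is the unit vector along \<open>(l, 2 r)\<close>, the displacement of the piece in the half plane of
    horizontal length and \<open>2 norm y\<close>; projecting the velocity on it loses nothing in total.\<close>
  define \<alpha> \<beta> where "\<alpha> = l / d" and "\<beta> = 2 * r / d"
  have unit: "\<alpha>\<^sup>2 + \<beta>\<^sup>2 = 1"
    using d0 unfolding \<alpha>_def \<beta>_def power_divide add_divide_distrib[symmetric]
    by (simp add: d2[symmetric] power_mult_distrib)
  define V where "V t = integral {p..t} v" for t
  define R where "R t = norm (snd (\<gamma> t))" for t
  define R' where "R' t = (snd (\<gamma> t) \<bullet> snd (D t)) / norm (snd (\<gamma> t))" for t
  have contR: "continuous_on {p..c} R" unfolding R_def using cont by (intro continuous_intros)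
  have vint: "v integrable_on {p..c}" using l by blast
  have contV: "continuous_on {p..c} V" unfolding V_def by (rule indefinite_integral_continuous_1[OF vint])
  have contv: "continuous_on {p<..<c} v"
  proof -
    have "continuous_on {p<..<c} (\<lambda>t. sqrt (axes_metric g (fst (\<gamma> t)) (fst (D t)) (fst (D t))))"
    proof (rule axes_speed_continuous)
      show "continuous_on {p<..<c} (\<lambda>t. fst (\<gamma> t))"
        by (intro continuous_intros continuous_on_subset[OF cont]) auto
      show "continuous_on {p<..<c} (\<lambda>t. fst (D t))"
        by (intro continuous_intros contD)
      show "(fst (\<gamma> t), 0) \<in> U" if "t \<in> {p<..<c}" for t
        using proj_U[OF inU[OF that]] .
    qed
    then show ?thesis by (rule continuous_on_eq) (simp add: v)
  qed
  have derV: "(V has_real_derivative v t) (at t)" if t: "t \<in> {p<..<c}" for t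
  proof -
    have ct: "isCont v t" using contv t by (simp add: continuous_on_eq_continuous_at)
    have "((\<lambda>u. integral {p..u} v) has_vector_derivative v t) (at t within ({p..c} - {}))"
      using vint t ct by (intro integral_has_vector_derivative_continuous_at)
        (auto intro: continuous_at_imp_continuous_within)
    moreover have "at t within {p..c} = at t" using t by (intro at_within_interior) auto
    ultimately show ?thesis
      by (simp add: V_def[abs_def] has_real_derivative_iff_has_vector_derivative)
  qed
  have derR: "(R has_real_derivative R' t) (at t)" if t: "t \<in> {p<..<c}" for t
  proof -
    have "((\<lambda>t. snd (\<gamma> t)) has_derivative (\<lambda>h. h *\<^sub>R snd (D t))) (at t)"
      using bounded_linear.has_vector_derivative[OF bounded_linear_snd der[OF t]]
      by (simp add: has_vector_derivative_def)
    from has_derivative_compose[OF this has_derivative_norm[OF off[OF t]]]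
    have "(R has_derivative (\<lambda>h. sgn (snd (\<gamma> t)) \<bullet> (h *\<^sub>R snd (D t)))) (at t)"
      by (simp add: R_def[abs_def] inner_commute)
    moreover have "(\<lambda>h. sgn (snd (\<gamma> t)) \<bullet> (h *\<^sub>R snd (D t))) = (*) (R' t)"
      by (auto simp: R'_def sgn_div_norm divide_inverse fun_eq_iff)
    ultimately show ?thesis by (simp add: has_field_derivative_def)
  qed
  define P where "P t = k * (\<alpha> * V t - 2 * \<beta> * R t)" for t
  define F where "F t = k * (\<alpha> * v t - 2 * \<beta> * R' t)" for t
  have "ennreal (P c - P p) \<le> (\<integral>\<^sup>+t\<in>{p..c}. ennreal (sqrt (g (\<gamma> t) (vector_derivative \<gamma> (at t)) (vector_derivative \<gamma> (at t)))) \<partial>lborel)"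
  proof (rule increment_le_nn_integral[OF pc])
    show "continuous_on {p..c} P" unfolding P_def using contV contR by (intro continuous_intros)
    show "(P has_real_derivative F t) (at t)" if "p < t" "t < c" for t
      unfolding P_def[abs_def] F_def using that
      by (auto intro!: derivative_eq_intros derV derR)
    have "continuous_on {p<..<c} R'"
      unfolding R'_def
      by (intro continuous_intros contD continuous_on_subset[OF cont]) (use off in auto)
    then show "continuous_on {p<..<c} F" unfolding F_def using contv by (intro continuous_intros)
    show "AE t in lborel. t \<in> {p<..<c} \<longrightarrow> F t \<le> sqrt (g (\<gamma> t) (vector_derivative \<gamma> (at t)) (vector_derivative \<gamma> (at t)))"
      using AE_speed_ge[OF B1 B2 B3 r]
    proof (eventually_elim, safe)
      fix t assume t: "t \<in> {p<..<c}"
        and ge: "(1 - C * r\<^sup>2) * (axes_metric g (fst (\<gamma> t)) (fst (D t)) (fst (D t))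
           + 4 * ((snd (\<gamma> t) \<bullet> snd (D t)) / norm (snd (\<gamma> t)))\<^sup>2)
           \<le> g (\<gamma> t) (vector_derivative \<gamma> (at t)) (vector_derivative \<gamma> (at t))"
      have vv: "axes_metric g (fst (\<gamma> t)) (fst (D t)) (fst (D t)) = (v t)\<^sup>2"
        using axes_nonneg[OF proj_U[OF inU[OF t]]] v[OF t] by simp
      have "(v t)\<^sup>2 + 4 * (R' t)\<^sup>2 - (\<alpha> * v t - 2 * \<beta> * R' t)\<^sup>2 = (\<beta> * v t + 2 * \<alpha> * R' t)\<^sup>2"
        using unit by algebra
      then have "(\<alpha> * v t - 2 * \<beta> * R' t)\<^sup>2 \<le> (v t)\<^sup>2 + 4 * (R' t)\<^sup>2"
        using zero_le_power2[of "\<beta> * v t + 2 * \<alpha> * R' t"] by linarith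
      then have "k * (\<alpha> * v t - 2 * \<beta> * R' t)\<^sup>2 \<le> k * ((v t)\<^sup>2 + 4 * (R' t)\<^sup>2)"
        using k by (intro mult_left_mono)
      moreover have "(F t)\<^sup>2 \<le> k * (\<alpha> * v t - 2 * \<beta> * R' t)\<^sup>2"
        unfolding F_def power_mult_distrib using k
        by (intro mult_right_mono) (auto simp: power2_eq_square mult_left_le_one_le)
      ultimately show "F t \<le> sqrt (g (\<gamma> t) (vector_derivative \<gamma> (at t)) (vector_derivative \<gamma> (at t)))"
        using ge unfolding vv k_def[symmetric] R'_def[symmetric] by (intro real_le_rsqrt) linarith
    qed
  qed
  moreover have "P c - P p = k * d"
  proof -
    have "V p = 0" "V c = l" using l by (auto simp: V_def)
    moreover have "R p = r" "R c = 0" using ends by (auto simp: R_def)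
    ultimately have "P c - P p = k * (\<alpha> * l + 2 * \<beta> * r)" by (simp add: P_def algebra_simps)
    also have "\<alpha> * l + 2 * \<beta> * r = d\<^sup>2 / d" unfolding d2 \<alpha>_def \<beta>_def
      by (simp add: power2_eq_square add_divide_distrib)
    finally show ?thesis using d0 by (simp add: power2_eq_square)
  qed
  ultimately show ?thesis by (simp add: curve_length_def k_def d_def)
qed

text \<open>Near the axes the horizontal speed is at most twice the speed. Unlike the speed it is continuous, hence
measurable, so finite length makes it integrable.\<close>

lemma horizontal_speed_integrable:
  assumes pc: "p < c" and cont: "continuous_on {p..c} \<gamma>"
    and der: "\<And>t. t \<in> {p<..<c} \<Longrightarrow> (\<gamma> has_vector_derivative D t) (at t)"
    and contD: "continuous_on {p<..<c} D"
    and inU: "\<And>t. t \<in> {p<..<c} \<Longrightarrow> \<gamma> t \<in> U"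
    and small: "\<And>t. t \<in> {p<..<c} \<Longrightarrow> norm (snd (\<gamma> t)) \<le> r" and r: "C * r\<^sup>2 \<le> 1 / 2"
    and fin: "curve_length g p c \<gamma> < \<infinity>"
  shows "(\<lambda>t. sqrt (axes_metric g (fst (\<gamma> t)) (fst (D t)) (fst (D t)))) integrable_on {p..c}"
proof -
  have B1: "\<forall>t\<in>{p<..<c}. (\<gamma> has_vector_derivative D t) (at t)" using der by blast
  have B2: "\<forall>t\<in>{p<..<c}. \<gamma> t \<in> U" using inU by blast
  have B3: "\<forall>t\<in>{p<..<c}. norm (snd (\<gamma> t)) \<le> r" using small by blast
  have r1: "C * r\<^sup>2 \<le> 1" using r by simp
  define v where "v = (\<lambda>t. sqrt (axes_metric g (fst (\<gamma> t)) (fst (D t)) (fst (D t))))"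
  have U: "(fst (\<gamma> t), 0) \<in> U" if "t \<in> {p<..<c}" for t
    using proj_U[OF inU[OF that]] .
  have "continuous_on {p<..<c} v"
    unfolding v_def
    by (intro axes_speed_continuous continuous_intros contD U continuous_on_subset[OF cont]) auto
  then have meas: "(\<lambda>t. indicator {p<..<c} t *\<^sub>R v t) \<in> borel_measurable borel"
    by (intro borel_measurable_continuous_on_indicator) auto
  have "AE t in lborel. t \<in> {p<..<c} \<longrightarrow> ennreal (v t / 2)
      \<le> ennreal (sqrt (g (\<gamma> t) (vector_derivative \<gamma> (at t)) (vector_derivative \<gamma> (at t))))"
    using AE_speed_ge[OF B1 B2 B3 r1]
  proof (eventually_elim, safe)
    fix t assume t: "t \<in> {p<..<c}"
      and ge: "(1 - C * r\<^sup>2) * (axes_metric g (fst (\<gamma> t)) (fst (D t)) (fst (D t))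
           + 4 * ((snd (\<gamma> t) \<bullet> snd (D t)) / norm (snd (\<gamma> t)))\<^sup>2)
           \<le> g (\<gamma> t) (vector_derivative \<gamma> (at t)) (vector_derivative \<gamma> (at t))"
    have vv: "axes_metric g (fst (\<gamma> t)) (fst (D t)) (fst (D t)) = (v t)\<^sup>2"
      using axes_nonneg[OF U[OF t]] by (simp add: v_def)
    have "1 / 2 * (v t)\<^sup>2 \<le> (1 - C * r\<^sup>2) * ((v t)\<^sup>2 + 4 * ((snd (\<gamma> t) \<bullet> snd (D t)) / norm (snd (\<gamma> t)))\<^sup>2)"
      using r by (intro mult_mono) auto
    moreover have "(v t / 2)\<^sup>2 \<le> 1 / 2 * (v t)\<^sup>2" by (simp add: power_divide)
    ultimately show "ennreal (v t / 2)
      \<le> ennreal (sqrt (g (\<gamma> t) (vector_derivative \<gamma> (at t)) (vector_derivative \<gamma> (at t))))"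
      using ge unfolding vv by (intro ennreal_leI real_le_rsqrt) linarith
  qed
  then have "(\<integral>\<^sup>+t. ennreal (norm (indicator {p<..<c} t *\<^sub>R v t / 2)) \<partial>lborel) \<le> curve_length g p c \<gamma>"
    unfolding curve_length_def
    by (intro nn_integral_mono_AE, elim eventually_mono)
      (use axes_nonneg[OF U] in \<open>auto split: split_indicator simp: v_def\<close>)
  then have "integrable lborel (\<lambda>t. indicator {p<..<c} t *\<^sub>R v t / 2)"
    using meas fin by (intro integrableI_bounded) auto
  then have "integrable lborel (\<lambda>t. 2 * (indicator {p<..<c} t *\<^sub>R v t / 2))"
    by (rule integrable_mult_right)
  then have "set_integrable lborel {p<..<c} v"
    by (simp add: set_integrable_def)
  then have "v integrable_on {p<..<c}" by (rule set_borel_integral_eq_integral)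
  then show ?thesis by (simp add: v_def integrable_on_Icc_iff_Ioo)
qed

end

section \<open>Piecewise smooth curves and geodesic tails\<close>

lemma piecewise_C1_differentiable_bounded_linear:
  assumes L: "bounded_linear L" and f: "f piecewise_C1_differentiable_on S"
  shows "(\<lambda>t. L (f t)) piecewise_C1_differentiable_on S"
proof -
  from f obtain N where c: "continuous_on S f" and "finite N" and fC1: "f C1_differentiable_on (S - N)"
    unfolding piecewise_C1_differentiable_on_def by auto
  from fC1 obtain D where D: "\<forall>t\<in>S - N. (f has_vector_derivative D t) (at t)" "continuous_on (S - N) D"
    unfolding C1_differentiable_on_def by (elim exE conjE)
  have "(\<lambda>t. L (f t)) C1_differentiable_on (S - N)"
    unfolding C1_differentiable_on_def
  proof (intro exI conjI ballI)
    show "((\<lambda>t. L (f t)) has_vector_derivative L (D t)) (at t)" if "t \<in> S - N" for t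
      using bounded_linear.has_vector_derivative[OF L bspec[OF D(1) that]] .
    show "continuous_on (S - N) (\<lambda>t. L (D t))"
      using bounded_linear.continuous_on[OF L D(2)] .
  qed
  then show ?thesis
    using \<open>finite N\<close> bounded_linear.continuous_on[OF L c]
    unfolding piecewise_C1_differentiable_on_def by blast
qed

lemma C1_imp_piecewise:
  assumes "\<And>t. (f has_vector_derivative D t) (at t)" "continuous_on UNIV D"
  shows "f piecewise_C1_differentiable_on S"
proof (rule C1_differentiable_imp_piecewise)
  show "f C1_differentiable_on S"
    unfolding C1_differentiable_on_def using assms continuous_on_subset by blast
qed

lemma geodesic_on_subinterval:
  assumes "geodesic_on G a b \<sigma>" "a \<le> a'" and eq: "\<And>t. t \<in> {a'..b} \<Longrightarrow> \<tau> t = \<sigma> t"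
  shows "geodesic_on G a' b \<tau>"
proof -
  obtain \<sigma>' \<sigma>'' where s: "\<And>t. t \<in> {a..b} \<Longrightarrow>
        (\<sigma> has_vector_derivative \<sigma>' t) (at t within {a..b}) \<and>
        (\<sigma>' has_vector_derivative \<sigma>'' t) (at t within {a..b}) \<and>
        (\<forall>w. G (\<sigma> t) (\<sigma>'' t) w + christoffel1 G (\<sigma> t) (\<sigma>' t) (\<sigma>' t) w = 0)"
    using assms(1) unfolding geodesic_on_def by blast
  show ?thesis
    unfolding geodesic_on_def
  proof (intro exI ballI conjI)
    fix t assume t: "t \<in> {a'..b}"
    then have t': "t \<in> {a..b}" using assms(2) by auto
    have sub: "{a'..b} \<subseteq> {a..b}" using assms(2) by auto
    have "(\<sigma> has_vector_derivative \<sigma>' t) (at t within {a'..b})"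
      using s[OF t'] has_vector_derivative_within_subset[OF _ sub] by blast
    then show "(\<tau> has_vector_derivative \<sigma>' t) (at t within {a'..b})"
      using eq t by (intro has_vector_derivative_transform[of t "{a'..b}" \<tau> \<sigma>]) auto
    show "(\<sigma>' has_vector_derivative \<sigma>'' t) (at t within {a'..b})"
      using s[OF t'] has_vector_derivative_within_subset[OF _ sub] by blast
    show "\<forall>w. G (\<tau> t) (\<sigma>'' t) w + christoffel1 G (\<tau> t) (\<sigma>' t) (\<sigma>' t) w = 0"
      using s[OF t'] eq[OF t] by simp
  qed
qed

text \<open>At the contact time the curve itself need not be differentiable, but its tail has one-sided velocities
there. Taking these for \<open>u\<close> makes the velocity of the tail continuous on a compact interval.\<close>

lemma axes_tail_velocity:
  fixes \<gamma> :: "real \<Rightarrow> ('m::finite, 'n::finite) space"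
  assumes geo: "geodesic_on G c b (fst \<circ> \<gamma>)"
    and axes: "\<forall>t\<in>{c..b}. snd (\<gamma> t) = 0"
  obtains u where "continuous_on {c..b} u"
    and "\<forall>t\<in>{c<..<b}. (\<gamma> has_vector_derivative (u t, 0)) (at t)"
    and "\<forall>t\<in>{c..b}. ((fst \<circ> \<gamma>) has_vector_derivative u t) (at t within {c..b})"
proof -
  obtain \<sigma>' \<sigma>'' where s: "\<And>t. t \<in> {c..b} \<Longrightarrow>
        ((fst \<circ> \<gamma>) has_vector_derivative \<sigma>' t) (at t within {c..b})"
      "\<And>t. t \<in> {c..b} \<Longrightarrow> (\<sigma>' has_vector_derivative \<sigma>'' t) (at t within {c..b})"
    using geo unfolding geodesic_on_def by blast
  show ?thesis
  proof (rule that[of \<sigma>'])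
    show "continuous_on {c..b} \<sigma>'"
      using s(2) by (intro continuous_on_vector_derivative)
    show "\<forall>t\<in>{c..b}. ((fst \<circ> \<gamma>) has_vector_derivative \<sigma>' t) (at t within {c..b})"
      using s(1) by (rule ballI)
    show "\<forall>t\<in>{c<..<b}. (\<gamma> has_vector_derivative (\<sigma>' t, 0)) (at t)"
    proof
      fix t assume t: "t \<in> {c<..<b}"
      then have "at t within {c..b} = at t" by (intro at_within_interior) auto
      then have "((\<lambda>s. fst (\<gamma> s)) has_vector_derivative \<sigma>' t) (at t)"
        using s(1)[of t] t by (simp add: o_def)
      then have "((\<lambda>s. (fst (\<gamma> s), 0)) has_vector_derivative (\<sigma>' t, 0)) (at t)"
        by (intro has_vector_derivative_Pair) (auto intro: derivative_intros)
      then show "(\<gamma> has_vector_derivative (\<sigma>' t, 0)) (at t)"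
      proof (rule has_vector_derivative_transform_within_open[of _ _ _ "{c<..<b}"])
        show "(fst (\<gamma> s), 0) = \<gamma> s" if "s \<in> {c<..<b}" for s
          using axes that by (simp add: prod_eq_iff)
      qed (use t in auto)
    qed
  qed
qed

section \<open>A competitor of finite length\<close>

context cuspidal_estimates
begin

text \<open>The part of the curve before a time \<open>s\<close> close to \<open>c\<close> lies in one component of \<open>U\<close> minus the axes, and
a connected open set contains polynomial paths between its points. From \<open>\<gamma> s\<close> a straight segment
inside a ball around \<open>\<gamma> c\<close> reaches the axes; its \<open>y\<close>-component is a positive multiple of that of
\<open>\<gamma> s\<close> until the end. All velocities are bounded.\<close>

lemma finite_length_competitor:
  assumes off: "off_axes_then_geodesic U g a b \<gamma>"
  obtains a' \<delta> where "off_axes_then_geodesic U g a' b \<delta>" "\<delta> a' = \<gamma> a" "\<delta> b = \<gamma> b"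
    "curve_length g a' b \<delta> < \<infinity>"
proof -
  obtain c where c: "a < c" "c < b" and offc: "\<And>t. t \<in> {a..<c} \<Longrightarrow> snd (\<gamma> t) \<noteq> 0"
    and onc: "\<And>t. t \<in> {c..b} \<Longrightarrow> snd (\<gamma> t) = 0"
    and geo: "geodesic_on (axes_metric g) c b (fst \<circ> \<gamma>)" and nonconst: "\<not> (fst \<circ> \<gamma>) constant_on {c..b}"
    and crv: "curve_in U a b \<gamma>"
    using off unfolding off_axes_then_geodesic_def by blast
  have cont: "continuous_on {a..b} \<gamma>" and inU: "\<And>t. t \<in> {a..b} \<Longrightarrow> \<gamma> t \<in> U"
    and pC1: "\<gamma> piecewise_C1_differentiable_on {a..b}"
    using crv unfolding curve_in_def piecewise_C1_differentiable_on_def by auto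
  have "\<gamma> c \<in> U" using inU c by auto
  then obtain \<epsilon> where \<epsilon>: "\<epsilon> > 0" "ball (\<gamma> c) \<epsilon> \<subseteq> U" using open_U open_contains_ball by blast
  have "(\<gamma> \<longlongrightarrow> \<gamma> c) (at_left c)"
    using continuous_on_Icc_at_leftD[OF continuous_on_subset[OF cont, of "{a..c}"]] c by auto
  then have "\<forall>\<^sub>F t in at_left c. dist (\<gamma> t) (\<gamma> c) < \<epsilon>" using \<epsilon> tendstoD by blast
  then have "\<forall>\<^sub>F t in at_left c. dist (\<gamma> t) (\<gamma> c) < \<epsilon> \<and> t \<in> {a<..<c}"
    using eventually_at_left_real[OF c(1)] by eventually_elim auto
  then obtain s where s: "dist (\<gamma> s) (\<gamma> c) < \<epsilon>" "a < s" "s < c"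
    using eventually_happens'[OF trivial_limit_at_left_real] by force
  define V where "V = U \<inter> - (snd -` {0})"
  have "closed (snd -` {0 :: real^2^'n} :: ('m, 'n) space set)"
    by (intro closed_vimage continuous_intros closed_singleton)
  then have oV: "open V" unfolding V_def using open_U by (intro open_Int open_Compl)
  have imV: "\<gamma> ` {a..s} \<subseteq> V"
    using inU offc s c by (auto simp: V_def)
  have conn: "connected (\<gamma> ` {a..s})"
    using cont c s by (intro connected_continuous_image continuous_on_subset[OF cont]) auto
  define W where "W = connected_component_set V (\<gamma> a)"
  have W: "open W" "connected W" "W \<subseteq> V" unfolding W_def
    using oV by (auto simp: open_connected_component connected_component_subset)
  have "\<gamma> ` {a..s} \<subseteq> W"
    unfolding W_def using conn imV s by (intro connected_component_maximal) auto
  then have "\<gamma> a \<in> W" "\<gamma> s \<in> W" using s by auto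
  from connected_open_polynomial_connected[OF W(1,2) this]
  obtain P where P: "polynomial_function P" "path_image P \<subseteq> W" "P 0 = \<gamma> a" "P 1 = \<gamma> s"
    by (auto simp: pathstart_def pathfinish_def)
  obtain P' where P': "polynomial_function P'" "\<And>t. (P has_vector_derivative P' t) (at t)"
    using has_vector_derivative_polynomial_function[OF P(1)] by blast
  \<comment> \<open>The new first segment takes two units of time ending at \<open>c\<close>, so that the tail keeps its
    parametrization.\<close>
  define a' where "a' = c - 2"
  define \<delta>1 where "\<delta>1 t = P (t - a')" for t
  define \<delta>2 where "\<delta>2 t = \<gamma> s + (t - (c - 1)) *\<^sub>R (\<gamma> c - \<gamma> s)" for t
  define \<delta> where "\<delta> t = (if t \<le> c - 1 then \<delta>1 t else if t \<le> c then \<delta>2 t else \<gamma> t)" for t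
  have d1: "(\<delta>1 has_vector_derivative P' (t - a')) (at t)" for t
  proof -
    have "((\<lambda>t. t - a') has_vector_derivative 1) (at t)" by (auto intro!: derivative_eq_intros)
    from vector_diff_chain_at[OF this P'(2)] show ?thesis by (simp add: \<delta>1_def[abs_def] o_def)
  qed
  have d2: "(\<delta>2 has_vector_derivative (\<gamma> c - \<gamma> s)) (at t)" for t
    unfolding \<delta>2_def by (auto intro!: derivative_eq_intros)
  have cP': "continuous_on T (\<lambda>t. P' (t - a'))" for T
    by (rule continuous_on_compose2[OF continuous_on_polymonial_function[OF P'(1), of UNIV]])
      (auto intro!: continuous_intros)
  have joins: "\<delta>1 (c - 1) = \<delta>2 (c - 1)" "\<delta>2 c = \<gamma> c" "\<delta>1 a' = \<gamma> a"
    using P by (auto simp: \<delta>1_def \<delta>2_def a'_def)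
  have pC1': "\<delta> piecewise_C1_differentiable_on {a'..b}"
    unfolding \<delta>_def
  proof (intro piecewise_C1_differentiable_cases)
    show "\<delta>1 piecewise_C1_differentiable_on {a'..c - 1}" using d1 cP' by (rule C1_imp_piecewise)
    show "\<delta>2 piecewise_C1_differentiable_on {c - 1..c}"
      using d2 by (rule C1_imp_piecewise) (auto intro: continuous_intros)
    show "\<gamma> piecewise_C1_differentiable_on {c..b}"
      using pC1 c by (rule_tac piecewise_C1_differentiable_on_subset) auto
  qed (use c joins in \<open>auto simp: a'_def\<close>)
  have in1: "\<delta>1 t \<in> V" if "t \<in> {a'..c - 1}" for t
  proof -
    have "\<delta>1 t \<in> path_image P" using that unfolding \<delta>1_def path_image_def a'_def by (intro imageI) auto
    then show ?thesis using P W by blast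
  qed
  have in2: "\<delta>2 t \<in> U" if "t \<in> {c - 1..c}" for t
  proof -
    have "\<delta>2 t - \<gamma> c = (c - t) *\<^sub>R (\<gamma> s - \<gamma> c)" by (simp add: \<delta>2_def algebra_simps)
    then have "dist (\<delta>2 t) (\<gamma> c) = \<bar>c - t\<bar> * dist (\<gamma> s) (\<gamma> c)" by (simp add: dist_norm)
    also have "\<dots> \<le> 1 * dist (\<gamma> s) (\<gamma> c)" using that by (intro mult_right_mono) auto
    finally have "\<delta>2 t \<in> ball (\<gamma> c) \<epsilon>" using s by (simp add: dist_commute)
    then show ?thesis using \<epsilon> by blast
  qed
  have snd2: "snd (\<delta>2 t) = (c - t) *\<^sub>R snd (\<gamma> s)" for t
    using onc[of c] c by (simp add: \<delta>2_def algebra_simps)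
  have in\<delta>: "\<delta> ` {a'..b} \<subseteq> U"
    using in1 in2 inU c by (auto simp: \<delta>_def V_def)
  have tail: "\<delta> t = \<gamma> t" if "t \<in> {c..b}" for t
    using that joins by (auto simp: \<delta>_def)
  have "off_axes_then_geodesic U g a' b \<delta>"
    unfolding off_axes_then_geodesic_def curve_in_def
  proof (intro conjI exI[of _ c])
    show "\<forall>t\<in>{a'..<c}. snd (\<delta> t) \<noteq> 0"
    proof
      fix t assume t: "t \<in> {a'..<c}"
      show "snd (\<delta> t) \<noteq> 0"
      proof (cases "t \<le> c - 1")
        case True then show ?thesis using in1[of t] t by (auto simp: \<delta>_def V_def)
      next
        case False then show ?thesis using t snd2[of t] offc[of s] s by (auto simp: \<delta>_def)
      qed
    qed
    show "\<forall>t\<in>{c..b}. snd (\<delta> t) = 0" using tail onc by simp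
    show "geodesic_on (axes_metric g) c b (fst \<circ> \<delta>)"
      using tail by (intro geodesic_on_subinterval[OF geo]) auto
    show "\<not> (fst \<circ> \<delta>) constant_on {c..b}"
      using nonconst tail by (simp add: constant_on_def)
  qed (use c pC1' in\<delta> in \<open>auto simp: a'_def\<close>)
  moreover have "\<delta> a' = \<gamma> a" "\<delta> b = \<gamma> b" using joins c by (auto simp: \<delta>_def a'_def)
  moreover have "curve_length g a' b \<delta> < \<infinity>"
  proof -
    have "curve_length g a' (c - 1) \<delta> = curve_length g a' (c - 1) \<delta>1"
      by (rule curve_length_cong) (auto simp: \<delta>_def)
    also have "\<dots> < \<infinity>"
    proof -
      have "compact ((\<lambda>t. P' (t - a')) ` {a'..c - 1})" by (intro compact_continuous_image cP') auto
      from compact_imp_bounded[OF this] obtain B where "\<And>t. t \<in> {a'..c - 1} \<Longrightarrow> norm (P' (t - a')) \<le> B"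
        unfolding bounded_iff by blast
      note B = this
      show ?thesis
      proof (rule curve_length_finite)
        show "continuous_on {a'..c - 1} \<delta>1"
          using has_vector_derivative_continuous[OF d1] by (intro continuous_at_imp_continuous_on) blast
        show "\<delta>1 ` {a'..c - 1} \<subseteq> U" using in1 by (auto simp: V_def)
        show "norm (P' (t - a')) \<le> B" if "t \<in> {a'<..<c - 1}" for t using B that by simp
      qed (rule d1)
    qed
    finally have l1: "curve_length g a' (c - 1) \<delta> < \<infinity>" .
    have "curve_length g (c - 1) c \<delta> = curve_length g (c - 1) c \<delta>2"
      by (rule curve_length_cong) (auto simp: \<delta>_def)
    also have "\<dots> < \<infinity>"
    proof (rule curve_length_finite)
      show "continuous_on {c - 1..c} \<delta>2"
        using has_vector_derivative_continuous[OF d2] by (intro continuous_at_imp_continuous_on) blast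
      show "\<delta>2 ` {c - 1..c} \<subseteq> U" using in2 by auto
    qed (rule d2, rule order_refl)
    finally have l2: "curve_length g (c - 1) c \<delta> < \<infinity>" .
    have onc': "\<forall>t\<in>{c..b}. snd (\<gamma> t) = 0" using onc by blast
    obtain u where u: "continuous_on {c..b} u"
      "\<forall>t\<in>{c<..<b}. (\<gamma> has_vector_derivative (u t, 0)) (at t)"
      by (rule axes_tail_velocity[OF geo onc'])
    have "compact (u ` {c..b})" using u by (intro compact_continuous_image) auto
    from compact_imp_bounded[OF this] obtain B where B: "\<And>t. t \<in> {c..b} \<Longrightarrow> norm (u t) \<le> B"
      unfolding bounded_iff by blast
    have "curve_length g c b \<delta> = curve_length g c b \<gamma>"
      by (rule curve_length_cong) (auto simp: \<delta>_def)
    also have "\<dots> < \<infinity>"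
    proof (rule curve_length_finite)
      show "continuous_on {c..b} \<gamma>" by (rule continuous_on_subset[OF cont]) (use c in auto)
      show "\<gamma> ` {c..b} \<subseteq> U" using inU c by auto
      show "norm (u t, 0 :: real^2^'n) \<le> B" if "t \<in> {c<..<b}" for t using B[of t] that by (simp add: norm_Pair)
    qed (rule bspec[OF u(2)])
    finally have l3: "curve_length g c b \<delta> < \<infinity>" .
    show ?thesis
      using l1 l2 l3 c curve_length_combine[of a' "c - 1" b g \<delta>] curve_length_combine[of "c - 1" c b g \<delta>]
      by (simp add: a'_def)
  qed
  ultimately show ?thesis by (rule that)
qed

end

section \<open>Holding the height and descending along the geodesic\<close>

text \<open>The \<open>x\<close>-component is that of \<open>\<gamma>\<close> at all times, and between \<open>t\<^sub>0\<close> and \<open>c\<^sub>2\<close> the \<open>y\<close>-component is a positive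
multiple of its value at \<open>t\<^sub>0\<close>; hence the curve first meets the axes at \<open>c\<^sub>2\<close>, on the old geodesic.\<close>

definition freeze_drop ::
  "(real \<Rightarrow> ('m::finite, 'n::finite) space) \<Rightarrow> real \<Rightarrow> real \<Rightarrow> real \<Rightarrow> real \<Rightarrow> ('m, 'n) space" where
  "freeze_drop \<gamma> t\<^sub>0 c\<^sub>1 c\<^sub>2 t =
     (if t \<le> t\<^sub>0 then \<gamma> t
      else if t \<le> c\<^sub>1 then (fst (\<gamma> t), snd (\<gamma> t\<^sub>0))
      else if t \<le> c\<^sub>2 then (fst (\<gamma> t), ((c\<^sub>2 - t) / (c\<^sub>2 - c\<^sub>1)) *\<^sub>R snd (\<gamma> t\<^sub>0))
      else \<gamma> t)"

lemma fst_freeze_drop: "fst (freeze_drop \<gamma> t\<^sub>0 c\<^sub>1 c\<^sub>2 t) = fst (\<gamma> t)"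
  by (simp add: freeze_drop_def)

lemma piecewise_C1_freeze_drop:
  assumes \<gamma>: "\<gamma> piecewise_C1_differentiable_on {a..b}"
    and ord: "a \<le> t\<^sub>0" "t\<^sub>0 < c\<^sub>1" "c\<^sub>1 < c\<^sub>2" "c\<^sub>2 \<le> b" and c2: "snd (\<gamma> c\<^sub>2) = 0"
  shows "freeze_drop \<gamma> t\<^sub>0 c\<^sub>1 c\<^sub>2 piecewise_C1_differentiable_on {a..b}"
proof -
  define y where "y = snd (\<gamma> t\<^sub>0)"
  have sub: "\<gamma> piecewise_C1_differentiable_on {p..q}" if "a \<le> p" "q \<le> b" for p q
    using \<gamma> by (rule piecewise_C1_differentiable_on_subset) (use that in auto)
  have x: "(\<lambda>t. (fst (\<gamma> t), 0)) piecewise_C1_differentiable_on {p..q}" if "a \<le> p" "q \<le> b" for p q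
    using sub[OF that]
    by (intro piecewise_C1_differentiable_bounded_linear[of "\<lambda>q. (fst q, 0)"] bounded_linear_Pair
        bounded_linear_fst bounded_linear_zero)
  have "(\<lambda>t. (fst (\<gamma> t), 0) + (0, y)) piecewise_C1_differentiable_on {t\<^sub>0..c\<^sub>1}"
    using ord by (intro piecewise_C1_differentiable_add x piecewise_C1_differentiable_const) auto
  then have p2: "(\<lambda>t. (fst (\<gamma> t), y)) piecewise_C1_differentiable_on {t\<^sub>0..c\<^sub>1}" by simp
  have "((\<lambda>t. ((c\<^sub>2 - t) / (c\<^sub>2 - c\<^sub>1)) *\<^sub>R (0, y)) has_vector_derivative
      (- 1 / (c\<^sub>2 - c\<^sub>1)) *\<^sub>R (0 :: real^2^'a, y)) (at t)" for t
    by (auto intro!: derivative_eq_intros simp: divide_inverse)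
  then have "(\<lambda>t. ((c\<^sub>2 - t) / (c\<^sub>2 - c\<^sub>1)) *\<^sub>R (0 :: real^2^'a, y)) piecewise_C1_differentiable_on {c\<^sub>1..c\<^sub>2}"
    by (rule C1_imp_piecewise) (rule continuous_on_const)
  then have "(\<lambda>t. (fst (\<gamma> t), 0) + ((c\<^sub>2 - t) / (c\<^sub>2 - c\<^sub>1)) *\<^sub>R (0 :: real^2^'a, y)) piecewise_C1_differentiable_on {c\<^sub>1..c\<^sub>2}"
    using ord by (intro piecewise_C1_differentiable_add x) auto
  then have p3: "(\<lambda>t. (fst (\<gamma> t), ((c\<^sub>2 - t) / (c\<^sub>2 - c\<^sub>1)) *\<^sub>R y)) piecewise_C1_differentiable_on {c\<^sub>1..c\<^sub>2}" by simp
  show ?thesis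
    unfolding freeze_drop_def[abs_def] y_def[symmetric]
  proof (intro piecewise_C1_differentiable_cases p2 p3 sub)
    show "(fst (\<gamma> c\<^sub>2), ((c\<^sub>2 - c\<^sub>2) / (c\<^sub>2 - c\<^sub>1)) *\<^sub>R y) = \<gamma> c\<^sub>2" using c2 by (simp add: prod_eq_iff)
  qed (use ord in \<open>auto simp: y_def\<close>)
qed

text \<open>The gain \<open>D - l = 4 r\<^sup>2 / (D + l)\<close> is at least \<open>2 r\<^sup>2 / e\<close>, since \<open>D + l \<le> 2 (l + r)\<close>. All losses together
are at most \<open>(3 C + K) r\<^sup>2\<close>.\<close>

lemma shortcut_arithmetic:
  fixes C K l r e D :: real
  assumes C: "0 \<le> C" and K: "0 \<le> K" and r: "0 < r" and l: "0 \<le> l"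
    and e: "l + r \<le> e" "e \<le> 1" "e * (3 * C + K) < 2"
    and D: "D = sqrt (l\<^sup>2 + 4 * r\<^sup>2)"
  shows "(1 + C * r\<^sup>2) * l + K * r\<^sup>2 < (1 - C * r\<^sup>2) * D"
proof -
  have D2: "D\<^sup>2 = l\<^sup>2 + 4 * r\<^sup>2" and D0: "D \<ge> 0" by (auto simp: D)
  have Dle: "D \<le> l + 2 * r"
    by (rule power2_le_imp_le) (use D0 D2 l r in \<open>auto simp: power2_sum\<close>)
  have Dl: "l < D"
    by (rule power2_less_imp_less[OF _ D0]) (use D2 r in auto)
  have "4 * r\<^sup>2 = (D - l) * (D + l)" using D2 by algebra
  also have "\<dots> \<le> (D - l) * (2 * e)" using Dl Dle e by (intro mult_left_mono) auto
  finally have "2 * r\<^sup>2 \<le> e * (D - l)" by simp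
  moreover have "(e * (3 * C + K)) * r\<^sup>2 < 2 * r\<^sup>2" using e r by (intro mult_strict_right_mono) auto
  ultimately have "e * ((3 * C + K) * r\<^sup>2) < e * (D - l)" by (simp add: algebra_simps)
  moreover have "e > 0" using l r e by auto
  ultimately have main: "(3 * C + K) * r\<^sup>2 < D - l" by simp
  have "C * (l + D) \<le> C * 3" using Dle e l r C by (intro mult_left_mono) auto
  then have "C * (l + D) * r\<^sup>2 \<le> C * 3 * r\<^sup>2" by (intro mult_right_mono) auto
  then show ?thesis using main by (simp add: algebra_simps)
qed

context cuspidal_estimates
begin

lemma off_axes_freeze_drop:
  assumes crv: "curve_in U a b \<gamma>"
    and ord: "a \<le> t\<^sub>0" "t\<^sub>0 < c" "c < c\<^sub>1" "c\<^sub>1 < c\<^sub>2" "c\<^sub>2 < b"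
    and offc: "\<forall>t\<in>{a..<c}. snd (\<gamma> t) \<noteq> 0" and onc: "\<forall>t\<in>{c..b}. snd (\<gamma> t) = 0"
    and tube: "\<forall>t\<in>{a..b}. \<forall>y. norm y \<le> norm (snd (\<gamma> t\<^sub>0)) \<longrightarrow> (fst (\<gamma> t), y) \<in> U"
    and geo: "geodesic_on (axes_metric g) c b (fst \<circ> \<gamma>)"
    and nonconst: "\<not> (fst \<circ> \<gamma>) constant_on {c\<^sub>2..b}"
  shows "off_axes_then_geodesic U g a b (freeze_drop \<gamma> t\<^sub>0 c\<^sub>1 c\<^sub>2)"
proof -
  let ?\<delta> = "freeze_drop \<gamma> t\<^sub>0 c\<^sub>1 c\<^sub>2"
  have pC1: "\<gamma> piecewise_C1_differentiable_on {a..b}" and inU: "\<gamma> ` {a..b} \<subseteq> U" and "a \<le> b"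
    using crv by (auto simp: curve_in_def)
  have \<delta>U: "?\<delta> ` {a..b} \<subseteq> U"
  proof (rule image_subsetI)
    fix t assume t: "t \<in> {a..b}"
    have frac: "\<bar>(c\<^sub>2 - t) / (c\<^sub>2 - c\<^sub>1)\<bar> \<le> 1" if "c\<^sub>1 < t" "t \<le> c\<^sub>2" using that ord by simp
    have "norm (((c\<^sub>2 - t) / (c\<^sub>2 - c\<^sub>1)) *\<^sub>R snd (\<gamma> t\<^sub>0)) \<le> norm (snd (\<gamma> t\<^sub>0))" if "c\<^sub>1 < t" "t \<le> c\<^sub>2"
      using mult_right_mono[OF frac[OF that], of "norm (snd (\<gamma> t\<^sub>0))"] by simp
    then show "?\<delta> t \<in> U"
      using bspec[OF tube t] inU t by (auto simp: freeze_drop_def simp del: norm_scaleR)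
  qed
  have on2: "?\<delta> t = \<gamma> t" if "t \<in> {c\<^sub>2..b}" for t
  proof (cases "t = c\<^sub>2")
    case True
    then show ?thesis using onc ord by (simp add: freeze_drop_def prod_eq_iff)
  next
    case False
    then show ?thesis using that ord by (simp add: freeze_drop_def)
  qed
  have fst\<delta>: "fst \<circ> ?\<delta> = fst \<circ> \<gamma>" by (simp add: fun_eq_iff fst_freeze_drop)
  show ?thesis
    unfolding off_axes_then_geodesic_def curve_in_def
  proof (intro conjI exI[of _ c\<^sub>2])
    show "?\<delta> piecewise_C1_differentiable_on {a..b}"
      using ord onc by (intro piecewise_C1_freeze_drop[OF pC1]) auto
    show "\<forall>t\<in>{a..<c\<^sub>2}. snd (?\<delta> t) \<noteq> 0"
      using ord offc by (auto simp: freeze_drop_def)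
    show "\<forall>t\<in>{c\<^sub>2..b}. snd (?\<delta> t) = 0"
      using on2 onc ord by simp
    show "geodesic_on (axes_metric g) c\<^sub>2 b (fst \<circ> ?\<delta>)"
      unfolding fst\<delta> by (rule geodesic_on_subinterval[OF geo]) (use ord in auto)
    show "\<not> (fst \<circ> ?\<delta>) constant_on {c\<^sub>2..b}" unfolding fst\<delta> by (rule nonconst)
  qed (use ord \<delta>U \<open>a \<le> b\<close> in auto)
qed

text \<open>The pieces over \<open>[a, t\<^sub>0]\<close> and \<open>[c\<^sub>2, b]\<close> are common to both curves and finite, so they cancel. Over
\<open>[t\<^sub>0, c]\<close> the old curve is at least a hypotenuse and the new one essentially its base \<open>l\<close>; over
\<open>[c, c\<^sub>2]\<close> the old length is \<open>J\<close> and the new one at most \<open>J + K r\<^sup>2\<close>.\<close>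

lemma freeze_drop_shorter:
  assumes ord: "a \<le> t\<^sub>0" "t\<^sub>0 < c" "c < c\<^sub>1" "c\<^sub>1 < c\<^sub>2" "c\<^sub>2 < b"
    and cont: "continuous_on {a..b} \<gamma>" and inU: "\<gamma> ` {a..b} \<subseteq> U"
    and derD: "\<forall>t\<in>{t\<^sub>0<..<c}. (\<gamma> has_vector_derivative D t) (at t)"
    and contD: "continuous_on {t\<^sub>0<..<c} D"
    and u: "continuous_on {c..b} u" "\<forall>t\<in>{c<..<b}. (\<gamma> has_vector_derivative (u t, 0)) (at t)"
    and offc: "\<forall>t\<in>{a..<c}. snd (\<gamma> t) \<noteq> 0" and onc: "\<forall>t\<in>{c..b}. snd (\<gamma> t) = 0"
    and r: "r = norm (snd (\<gamma> t\<^sub>0))" "r \<le> 1" "C * r\<^sup>2 \<le> 1"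
    and small: "\<forall>t\<in>{t\<^sub>0..c}. norm (snd (\<gamma> t)) \<le> r"
    and tube: "\<forall>t\<in>{a..b}. \<forall>y. norm y \<le> r \<longrightarrow> (fst (\<gamma> t), y) \<in> U"
    and l: "((\<lambda>t. sqrt (axes_metric g (fst (\<gamma> t)) (fst (D t)) (fst (D t)))) has_integral l) {t\<^sub>0..c}"
    and v0: "v0 > 0" "\<forall>t\<in>{c\<^sub>1..c\<^sub>2}. v0 \<le> sqrt (axes_metric g (fst (\<gamma> t)) (u t) (u t))"
    and J: "((\<lambda>t. sqrt (axes_metric g (fst (\<gamma> t)) (u t) (u t))) has_integral J) {c..c\<^sub>2}"
    and K: "K = C * J + (1 + C) * (5 / (2 * v0 * (c\<^sub>2 - c\<^sub>1)))"
    and e: "l + r \<le> e" "e \<le> 1" "e * (3 * C + K) < 2"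
    and fin: "curve_length g a b \<gamma> < \<infinity>"
  shows "curve_length g a b (freeze_drop \<gamma> t\<^sub>0 c\<^sub>1 c\<^sub>2) < curve_length g a b \<gamma>"
proof -
  let ?\<delta> = "freeze_drop \<gamma> t\<^sub>0 c\<^sub>1 c\<^sub>2"
  define y where "y = snd (\<gamma> t\<^sub>0)"
  define vl where "vl = (\<lambda>t. sqrt (axes_metric g (fst (\<gamma> t)) (fst (D t)) (fst (D t))))"
  define vr where "vr = (\<lambda>t. sqrt (axes_metric g (fst (\<gamma> t)) (u t) (u t)))"
  define d where "d = c\<^sub>2 - c\<^sub>1"
  \<comment> \<open>The descent has vertical speed \<open>r / d\<close>, and \<open>W r\<^sup>2\<close> is the excess speed with \<open>5 (r / d)\<^sup>2 = 2 W r\<^sup>2 v0\<close>.\<close>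
  define W where "W = 5 / (2 * v0 * d\<^sup>2)"
  have d: "d > 0" using ord by (simp add: d_def)
  have W0: "W \<ge> 0" using v0 by (simp add: W_def)
  have Wd: "W * d = 5 / (2 * v0 * (c\<^sub>2 - c\<^sub>1))" unfolding W_def d_def[symmetric] using d by (simp add: power2_eq_square)
  have r0: "r > 0" using r(1) offc ord by simp
  have U0: "(fst (\<gamma> t), 0) \<in> U" if "t \<in> {a..b}" for t
    using inU that by (intro proj_U) auto
  have vr0: "vr t \<ge> 0" if "t \<in> {a..b}" for t unfolding vr_def using axes_nonneg[OF U0[OF that]] by simp
  have vl0: "vl t \<ge> 0" if "t \<in> {a..b}" for t unfolding vl_def using axes_nonneg[OF U0[OF that]] by simp
  have Jr: "(vr has_integral J) {c..c\<^sub>2}" using J by (simp add: vr_def)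
  then have "vr integrable_on {c..c\<^sub>2}" by blast
  then have "vr integrable_on {c..c\<^sub>1}" "vr integrable_on {c\<^sub>1..c\<^sub>2}"
    using ord by (auto elim: integrable_subinterval_real)
  then obtain I1 I2 where I: "(vr has_integral I1) {c..c\<^sub>1}" "(vr has_integral I2) {c\<^sub>1..c\<^sub>2}"
    unfolding integrable_on_def by blast
  have JI: "J = I1 + I2"
    using has_integral_unique[OF Jr has_integral_combine[OF _ _ I]] ord by simp
  have l0: "l \<ge> 0" by (rule has_integral_nonneg[OF l]) (use vl0 ord in \<open>auto simp: vl_def\<close>)
  have I0: "I1 \<ge> 0" "I2 \<ge> 0"
    using has_integral_nonneg[OF I(1)] has_integral_nonneg[OF I(2)] vr0 ord by auto
  have K0: "K \<ge> 0" unfolding K using C_nonneg JI I0 v0 ord by auto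
  define L where "L = (1 - C * r\<^sup>2) * sqrt (l\<^sup>2 + 4 * r\<^sup>2)"
  have L0: "L \<ge> 0" unfolding L_def using r by simp
  have old1: "ennreal L \<le> curve_length g t\<^sub>0 c \<gamma>"
    unfolding L_def
  proof (rule curve_length_ge)
    show "continuous_on {t\<^sub>0..c} \<gamma>" by (rule continuous_on_subset[OF cont]) (use ord in auto)
    show "(vl has_integral l) {t\<^sub>0..c}" using l by (simp add: vl_def)
    show "\<gamma> t \<in> U" if "t \<in> {t\<^sub>0<..<c}" for t using inU ord that by auto
    show "snd (\<gamma> t) \<noteq> 0" if "t \<in> {t\<^sub>0<..<c}" for t using offc ord that by auto
    show "norm (snd (\<gamma> t)) \<le> r" if "t \<in> {t\<^sub>0<..<c}" for t using small that by auto
    show "snd (\<gamma> c) = 0" using onc ord by auto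
  qed (use ord contD r r0 bspec[OF derD] in \<open>auto simp: vl_def\<close>)
  have old2: "curve_length g c c\<^sub>1 \<gamma> = ennreal I1"
  proof (rule curve_length_on_axes[OF _ _ _ _ I(1)])
    show "(\<gamma> has_vector_derivative (u t, 0)) (at t)" if "t \<in> {c<..<c\<^sub>1}" for t using u(2) that ord by auto
    show "snd (\<gamma> t) = 0" if "t \<in> {c<..<c\<^sub>1}" for t using onc that ord by auto
    show "0 \<le> vr t" if "t \<in> {c..c\<^sub>1}" for t using that ord by (intro vr0) auto
  qed (simp add: vr_def)
  have old3: "curve_length g c\<^sub>1 c\<^sub>2 \<gamma> = ennreal I2"
  proof (rule curve_length_on_axes[OF _ _ _ _ I(2)])
    show "(\<gamma> has_vector_derivative (u t, 0)) (at t)" if "t \<in> {c\<^sub>1<..<c\<^sub>2}" for t using u(2) that ord by auto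
    show "snd (\<gamma> t) = 0" if "t \<in> {c\<^sub>1<..<c\<^sub>2}" for t using onc that ord by auto
    show "0 \<le> vr t" if "t \<in> {c\<^sub>1..c\<^sub>2}" for t using that ord by (intro vr0) auto
  qed (simp add: vr_def)
  have derx: "((\<lambda>t. (fst (\<gamma> t), f t)) has_vector_derivative (fst p, q)) (at t)"
    if "(\<gamma> has_vector_derivative p) (at t)" "(f has_vector_derivative q) (at t)"
    for t p q and f :: "real \<Rightarrow> real^2^'n"
    using bounded_linear.has_vector_derivative[OF bounded_linear_fst that(1)] that(2)
    by (rule has_vector_derivative_Pair)
  have frac: "\<bar>(c\<^sub>2 - t) / (c\<^sub>2 - c\<^sub>1)\<bar> \<le> 1" if "t \<in> {c\<^sub>1<..<c\<^sub>2}" for t using that ord by simp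
  have new1: "curve_length g t\<^sub>0 c ?\<delta> \<le> ennreal ((1 + C * r\<^sup>2) * (l + 0 * (c - t\<^sub>0)))"
  proof -
    have "curve_length g t\<^sub>0 c ?\<delta> = curve_length g t\<^sub>0 c (\<lambda>t. (fst (\<gamma> t), y))"
      using ord by (intro curve_length_cong) (simp add: freeze_drop_def y_def)
    also have "\<dots> \<le> ennreal ((1 + C * r\<^sup>2) * (l + 0 * (c - t\<^sub>0)))"
    proof (rule curve_length_le)
      show "((\<lambda>t. (fst (\<gamma> t), y)) has_vector_derivative (fst (D t), 0)) (at t)" if "t \<in> {t\<^sub>0<..<c}" for t
        by (intro derx bspec[OF derD that] has_vector_derivative_const)
      show "(fst (\<gamma> t), y) \<in> U" if "t \<in> {t\<^sub>0<..<c}" for t using tube that ord r by (auto simp: y_def)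
      show "(vl has_integral l) {t\<^sub>0..c}" using l by (simp add: vl_def)
      show "0 \<le> vl t" if "t \<in> {t\<^sub>0..c}" for t using that ord by (intro vl0) auto
    qed (use r ord in \<open>auto simp: vl_def y_def\<close>)
    finally show ?thesis .
  qed
  have new2: "curve_length g c c\<^sub>1 ?\<delta> \<le> ennreal ((1 + C * r\<^sup>2) * (I1 + 0 * (c\<^sub>1 - c)))"
  proof -
    have "curve_length g c c\<^sub>1 ?\<delta> = curve_length g c c\<^sub>1 (\<lambda>t. (fst (\<gamma> t), y))"
      using ord by (intro curve_length_cong) (simp add: freeze_drop_def y_def)
    also have "\<dots> \<le> ennreal ((1 + C * r\<^sup>2) * (I1 + 0 * (c\<^sub>1 - c)))"
    proof (rule curve_length_le[OF _ _ _ _ _ _ _ _ I(1)])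
      show "((\<lambda>t. (fst (\<gamma> t), y)) has_vector_derivative (fst (u t, 0 :: real^2^'n), 0)) (at t)"
        if "t \<in> {c<..<c\<^sub>1}" for t
        by (intro derx bspec[OF u(2)] has_vector_derivative_const) (use that ord in auto)
      show "(fst (\<gamma> t), y) \<in> U" if "t \<in> {c<..<c\<^sub>1}" for t using tube that ord r by (auto simp: y_def)
      show "0 \<le> vr t" if "t \<in> {c..c\<^sub>1}" for t using that ord by (intro vr0) auto
    qed (use r ord in \<open>auto simp: vr_def y_def\<close>)
    finally show ?thesis .
  qed
  have new3: "curve_length g c\<^sub>1 c\<^sub>2 ?\<delta> \<le> ennreal ((1 + C * r\<^sup>2) * (I2 + W * r\<^sup>2 * (c\<^sub>2 - c\<^sub>1)))"
  proof -
    have "curve_length g c\<^sub>1 c\<^sub>2 ?\<delta>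
        = curve_length g c\<^sub>1 c\<^sub>2 (\<lambda>t. (fst (\<gamma> t), ((c\<^sub>2 - t) / (c\<^sub>2 - c\<^sub>1)) *\<^sub>R y))"
      using ord by (intro curve_length_cong) (simp add: freeze_drop_def y_def)
    also have "\<dots> \<le> ennreal ((1 + C * r\<^sup>2) * (I2 + W * r\<^sup>2 * (c\<^sub>2 - c\<^sub>1)))"
    proof (rule curve_length_le[OF _ _ _ _ _ _ _ _ I(2)])
      show "((\<lambda>t. (fst (\<gamma> t), ((c\<^sub>2 - t) / (c\<^sub>2 - c\<^sub>1)) *\<^sub>R y)) has_vector_derivative
          (fst (u t, 0 :: real^2^'n), (- 1 / d) *\<^sub>R y)) (at t)" if t: "t \<in> {c\<^sub>1<..<c\<^sub>2}" for t
      proof (intro derx bspec[OF u(2)])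
        show "((\<lambda>t. ((c\<^sub>2 - t) / (c\<^sub>2 - c\<^sub>1)) *\<^sub>R y) has_vector_derivative (- 1 / d) *\<^sub>R y) (at t)"
          by (auto intro!: derivative_eq_intros simp: d_def divide_inverse)
      qed (use t ord in auto)
      show n: "norm (snd (fst (\<gamma> t), ((c\<^sub>2 - t) / (c\<^sub>2 - c\<^sub>1)) *\<^sub>R y)) \<le> r" if "t \<in> {c\<^sub>1<..<c\<^sub>2}" for t
        using mult_right_mono[OF frac[OF that], of "norm y"] r by (simp add: y_def)
      show "(fst (\<gamma> t), ((c\<^sub>2 - t) / (c\<^sub>2 - c\<^sub>1)) *\<^sub>R y) \<in> U" if t: "t \<in> {c\<^sub>1<..<c\<^sub>2}" for t
      proof -
        have "t \<in> {a..b}" using t ord by auto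
        from bspec[OF tube this] n[OF t] show ?thesis by (simp del: norm_scaleR)
      qed
      show "0 \<le> vr t" if "t \<in> {c\<^sub>1..c\<^sub>2}" for t using that ord by (intro vr0) auto
      show "5 * (norm (snd (fst (u t, 0 :: real^2^'n), (- 1 / d) *\<^sub>R y)))\<^sup>2 \<le> 2 * (W * r\<^sup>2) * vr t"
        if t: "t \<in> {c\<^sub>1<..<c\<^sub>2}" for t
      proof -
        have "norm ((- 1 / d) *\<^sub>R y) = r / d" using d r(1) by (simp add: y_def)
        then have "5 * (norm (snd (fst (u t, 0 :: real^2^'n), (- 1 / d) *\<^sub>R y)))\<^sup>2 = 2 * (W * r\<^sup>2) * v0"
          using v0(1) d by (simp add: W_def power_divide)
        also have "\<dots> \<le> 2 * (W * r\<^sup>2) * vr t"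
          using v0(2) t W0 unfolding vr_def by (intro mult_left_mono) auto
        finally show ?thesis .
      qed
      show "W * r\<^sup>2 \<ge> 0" using W0 by simp
    qed (use r ord in \<open>auto simp: vr_def\<close>)
    finally show ?thesis .
  qed
  have same: "curve_length g a t\<^sub>0 ?\<delta> = curve_length g a t\<^sub>0 \<gamma>" "curve_length g c\<^sub>2 b ?\<delta> = curve_length g c\<^sub>2 b \<gamma>"
    using ord by (auto intro!: curve_length_cong simp: freeze_drop_def)
  have split: "curve_length g a b f = curve_length g a t\<^sub>0 f + (curve_length g t\<^sub>0 c f + (curve_length g c c\<^sub>1 f
      + (curve_length g c\<^sub>1 c\<^sub>2 f + curve_length g c\<^sub>2 b f)))" for f
    using ord curve_length_combine[of a t\<^sub>0 b g f] curve_length_combine[of t\<^sub>0 c b g f]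
      curve_length_combine[of c c\<^sub>1 b g f] curve_length_combine[of c\<^sub>1 c\<^sub>2 b g f] by simp
  have "curve_length g a t\<^sub>0 \<gamma> < \<infinity>" "curve_length g c\<^sub>2 b \<gamma> < \<infinity>"
    using fin unfolding split[of \<gamma>] by (auto simp: ennreal_add_eq_top less_top)
  then obtain A B where AB: "curve_length g a t\<^sub>0 \<gamma> = ennreal A" "0 \<le> A"
    "curve_length g c\<^sub>2 b \<gamma> = ennreal B" "0 \<le> B"
    by (metis ennreal_cases infinity_ennreal_def less_irrefl)
  define x1 x2 x3 where "x1 = (1 + C * r\<^sup>2) * l" and "x2 = (1 + C * r\<^sup>2) * I1"
    and "x3 = (1 + C * r\<^sup>2) * (I2 + W * r\<^sup>2 * (c\<^sub>2 - c\<^sub>1))"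
  have x0: "x1 \<ge> 0" "x2 \<ge> 0" "x3 \<ge> 0"
    using C_nonneg l0 I0 W0 ord by (auto simp: x1_def x2_def x3_def)
  have arith: "x1 + K * r\<^sup>2 < L"
    unfolding x1_def L_def using shortcut_arithmetic[OF C_nonneg K0 r0 l0 e refl] .
  have "x2 + x3 \<le> I1 + I2 + K * r\<^sup>2"
  proof -
    have "(C * r\<^sup>2) * (W * d * r\<^sup>2) \<le> C * (W * d * r\<^sup>2)"
    proof (intro mult_right_mono)
      show "C * r\<^sup>2 \<le> C" using r r0 C_nonneg by (intro mult_left_le) (auto simp: power_le_one)
    qed (use W0 d in auto)
    moreover have "x2 + x3 = I1 + I2 + C * J * r\<^sup>2 + W * d * r\<^sup>2 + (C * r\<^sup>2) * (W * d * r\<^sup>2)"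
      unfolding x2_def x3_def JI d_def by algebra
    moreover have "K * r\<^sup>2 = C * J * r\<^sup>2 + W * d * r\<^sup>2 + C * (W * d * r\<^sup>2)"
      unfolding K Wd[symmetric] by algebra
    ultimately show ?thesis by linarith
  qed
  with arith have less: "A + (x1 + (x2 + (x3 + B))) < A + (L + (I1 + (I2 + B)))" by linarith
  have "curve_length g a b ?\<delta> \<le> ennreal A + (ennreal x1 + (ennreal x2 + (ennreal x3 + ennreal B)))"
    unfolding split[of ?\<delta>] same AB
    using new1 new2 new3 by (intro add_mono order_refl) (simp_all add: x1_def x2_def x3_def)
  also have "\<dots> = ennreal (A + (x1 + (x2 + (x3 + B))))"
    using AB x0 by simp
  also have "\<dots> < ennreal (A + (L + (I1 + (I2 + B))))"
    using less AB x0 by (intro ennreal_lessI) linarith+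
  also have "\<dots> = ennreal A + (ennreal L + (ennreal I1 + (ennreal I2 + ennreal B)))"
    using AB L0 I0 by simp
  also have "\<dots> \<le> curve_length g a b \<gamma>"
    unfolding split[of \<gamma>] AB old2 old3 using old1 by (intro add_mono order_refl)
  finally show ?thesis .
qed

lemma shorter_competitor:
  assumes off: "off_axes_then_geodesic U g a b \<gamma>" and fin: "curve_length g a b \<gamma> < \<infinity>"
  shows "\<exists>\<delta>. off_axes_then_geodesic U g a b \<delta> \<and> \<delta> a = \<gamma> a \<and> \<delta> b = \<gamma> b \<and>
    curve_length g a b \<delta> < curve_length g a b \<gamma>"
proof -
  obtain c where c: "a < c" "c < b" and offc: "\<forall>t\<in>{a..<c}. snd (\<gamma> t) \<noteq> 0"
    and onc: "\<forall>t\<in>{c..b}. snd (\<gamma> t) = 0"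
    and geo: "geodesic_on (axes_metric g) c b (fst \<circ> \<gamma>)" and nonconst: "\<not> (fst \<circ> \<gamma>) constant_on {c..b}"
    and crv: "curve_in U a b \<gamma>"
    using off unfolding off_axes_then_geodesic_def by (elim exE conjE)
  have cont: "continuous_on {a..b} \<gamma>" and inU: "\<gamma> ` {a..b} \<subseteq> U"
    and pC1: "\<gamma> piecewise_C1_differentiable_on {a..b}"
    using crv unfolding curve_in_def piecewise_C1_differentiable_on_def by auto
  from pC1 obtain N where N: "finite N" and C1: "\<gamma> C1_differentiable_on ({a..b} - N)"
    unfolding piecewise_C1_differentiable_on_def by (elim exE conjE)
  from C1 obtain D where D: "\<forall>t\<in>{a..b} - N. (\<gamma> has_vector_derivative D t) (at t)"
    and contD: "continuous_on ({a..b} - N) D"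
    unfolding C1_differentiable_on_def by (elim exE conjE)
  obtain u where u: "continuous_on {c..b} u" "\<forall>t\<in>{c<..<b}. (\<gamma> has_vector_derivative (u t, 0)) (at t)"
    and \<sigma>u: "\<forall>t\<in>{c..b}. ((fst \<circ> \<gamma>) has_vector_derivative u t) (at t within {c..b})"
    by (rule axes_tail_velocity[OF geo onc])
  have cont\<sigma>: "continuous_on {c..b} (\<lambda>t. fst (\<gamma> t))"
    by (intro continuous_intros continuous_on_subset[OF cont]) (use c in auto)
  define vr where "vr = (\<lambda>t. sqrt (axes_metric g (fst (\<gamma> t)) (u t) (u t)))"
  have U0: "(fst (\<gamma> t), 0) \<in> U" if "t \<in> {a..b}" for t using inU that by (intro proj_U) auto
  have contvr: "continuous_on {c..b} vr"
    unfolding vr_def using c by (intro axes_speed_continuous cont\<sigma> u(1) U0) auto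
  \<comment> \<open>The descent has to take place where the horizontal speed is bounded below, and the geodesic
    must not be constant afterwards. An interior time \<open>c\<^sub>2\<close> of nonzero velocity serves both: the speed
    stays above half its value on an interval ending there, and the geodesic still moves after it.\<close>
  have "\<exists>s\<in>{c<..<b}. u s \<noteq> 0"
  proof (rule ccontr)
    assume "\<not> ?thesis"
    then have "((fst \<circ> \<gamma>) has_derivative (\<lambda>h. 0)) (at t within {c..b})" if "t \<in> {c..b} - {c, b}" for t
      using bspec[OF \<sigma>u, of t] that by (auto simp: has_vector_derivative_def)
    note der0 = this
    have "(fst \<circ> \<gamma>) t = (fst \<circ> \<gamma>) c" if "t \<in> {c..b}" for t
    proof (rule has_derivative_zero_unique_strong_interval)
      show "continuous_on {c..b} (fst \<circ> \<gamma>)" using cont\<sigma> by (simp add: o_def)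
      show "finite {c, b}" by simp
    qed (rule refl, rule der0, assumption, rule that)
    then show False using nonconst unfolding constant_on_def by blast
  qed
  then obtain c\<^sub>2 where c2: "c < c\<^sub>2" "c\<^sub>2 < b" "u c\<^sub>2 \<noteq> 0" by auto
  have "vr c\<^sub>2 > 0" unfolding vr_def using axes_pos[OF U0 c2(3)] c2 c by simp
  have "isCont vr c\<^sub>2"
    using continuous_on_interior[OF contvr] c2 by simp
  then have "(vr \<longlongrightarrow> vr c\<^sub>2) (at_left c\<^sub>2)"
    unfolding isCont_def by (rule tendsto_within_subset) simp
  from order_tendstoD(1)[OF this, of "vr c\<^sub>2 / 2"]
  have "\<forall>\<^sub>F t in at_left c\<^sub>2. vr c\<^sub>2 / 2 < vr t"
    using \<open>vr c\<^sub>2 > 0\<close> by simp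
  then obtain c\<^sub>1' where c1': "c\<^sub>1' < c\<^sub>2" "\<forall>t>c\<^sub>1'. t < c\<^sub>2 \<longrightarrow> vr c\<^sub>2 / 2 < vr t"
    by (auto simp: eventually_at_left[OF c2(1)])
  define c\<^sub>1 where "c\<^sub>1 = (max c c\<^sub>1' + c\<^sub>2) / 2"
  have c1: "c < c\<^sub>1" "c\<^sub>1' < c\<^sub>1" "c\<^sub>1 < c\<^sub>2" using c2 c1' by (auto simp: c\<^sub>1_def)
  define v0 where "v0 = vr c\<^sub>2 / 2"
  have v0: "v0 > 0" "\<forall>t\<in>{c\<^sub>1..c\<^sub>2}. v0 \<le> vr t"
  proof -
    show "v0 > 0" using \<open>vr c\<^sub>2 > 0\<close> by (simp add: v0_def)
    show "\<forall>t\<in>{c\<^sub>1..c\<^sub>2}. v0 \<le> vr t"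
    proof
      fix t assume t: "t \<in> {c\<^sub>1..c\<^sub>2}"
      show "v0 \<le> vr t"
      proof (cases "t = c\<^sub>2")
        case True then show ?thesis using \<open>vr c\<^sub>2 > 0\<close> by (simp add: v0_def)
      next
        case False
        then have "vr c\<^sub>2 / 2 < vr t" using c1'(2) t c1 by simp
        then show ?thesis by (simp add: v0_def)
      qed
    qed
  qed
  have nonconst2: "\<not> (fst \<circ> \<gamma>) constant_on {c\<^sub>2..b}"
  proof
    assume "(fst \<circ> \<gamma>) constant_on {c\<^sub>2..b}"
    then obtain k where k: "\<forall>t\<in>{c\<^sub>2..b}. (fst \<circ> \<gamma>) t = k" unfolding constant_on_def by blast
    have "((fst \<circ> \<gamma>) has_vector_derivative u c\<^sub>2) (at c\<^sub>2 within {c\<^sub>2..b})"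
      using bspec[OF \<sigma>u, of c\<^sub>2] c2 by (auto intro: has_vector_derivative_within_subset)
    moreover have "((fst \<circ> \<gamma>) has_vector_derivative 0) (at c\<^sub>2 within {c\<^sub>2..b})"
      by (rule has_vector_derivative_transform[of _ _ _ "\<lambda>_. k"]) (use c2 k in auto)
    ultimately have "u c\<^sub>2 = 0"
      using c2 by (intro vector_derivative_unique_within[of c\<^sub>2 "{c\<^sub>2..b}" "fst \<circ> \<gamma>"])
        (auto simp: trivial_limit_within)
    then show False using c2 by simp
  qed
  have "vr integrable_on {c..c\<^sub>2}"
    using c2 by (intro integrable_continuous_real continuous_on_subset[OF contvr]) auto
  then obtain J where J: "(vr has_integral J) {c..c\<^sub>2}" by blast
  have J0: "J \<ge> 0"
    by (rule has_integral_nonneg[OF J]) (use axes_nonneg[OF U0] c c2 in \<open>auto simp: vr_def\<close>)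
  \<comment> \<open>\<open>K r\<^sup>2\<close> bounds the length added on the tail. It is fixed before \<open>t\<^sub>0\<close> is chosen, which is what lets
    \<open>l + r\<close> be made small compared with it.\<close>
  define K where "K = C * J + (1 + C) * (5 / (2 * v0 * (c\<^sub>2 - c\<^sub>1)))"
  have K0: "K \<ge> 0" unfolding K_def using C_nonneg J0 v0 c1 by auto
  define e where "e = min 1 (1 / (3 * C + K + 1))"
  have pos: "3 * C + K + 1 > 0" using C_nonneg K0 by linarith
  have e: "e > 0" "e \<le> 1" "e * (3 * C + K) < 2"
  proof -
    show "e > 0" "e \<le> 1" using pos by (auto simp: e_def)
    have "e * (3 * C + K) \<le> 1 / (3 * C + K + 1) * (3 * C + K)"
      using C_nonneg K0 by (intro mult_right_mono) (auto simp: e_def)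
    also have "\<dots> < 2" using pos by (simp add: field_simps)
    finally show "e * (3 * C + K) < 2" .
  qed
  \<comment> \<open>A tube around the projection of the whole curve to the axes lies in \<open>U\<close>.\<close>
  define X where "X = (\<lambda>t. (fst (\<gamma> t), 0 :: real^2^'n)) ` {a..b}"
  have "compact X" unfolding X_def using cont by (intro compact_continuous_image continuous_intros) auto
  moreover have "X \<subseteq> U" unfolding X_def using U0 by auto
  moreover have "X \<noteq> {}" using c by (auto simp: X_def)
  ultimately obtain \<epsilon> where \<epsilon>: "\<epsilon> > 0" "{p. infdist p X \<le> \<epsilon>} \<subseteq> U"
    using compact_in_open_separated[of X U] open_U by blast
  have tube: "(fst (\<gamma> t), y) \<in> U" if "t \<in> {a..b}" "norm y \<le> \<epsilon>" for t y
  proof -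
    have "infdist (fst (\<gamma> t), y) X \<le> dist (fst (\<gamma> t), y) (fst (\<gamma> t), 0)"
      using that by (intro infdist_le) (auto simp: X_def)
    then have "infdist (fst (\<gamma> t), y) X \<le> \<epsilon>" using that by (simp add: dist_Pair_Pair)
    then show ?thesis using \<epsilon> by blast
  qed
  \<comment> \<open>\<open>\<rho>\<close> bounds the height: it keeps the competitor in \<open>U\<close>, makes the lower length bound nontrivial,
    and leaves room for \<open>l + r \<le> e\<close>.\<close>
  have limy: "((\<lambda>t. norm (snd (\<gamma> t))) \<longlongrightarrow> 0) (at_left c)"
  proof -
    have "continuous_on {a..c} (\<lambda>t. norm (snd (\<gamma> t)))"
      by (intro continuous_intros continuous_on_subset[OF cont]) (use c in auto)
    from continuous_on_Icc_at_leftD[OF this c(1)] show ?thesis using onc c by simp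
  qed
  define \<rho> where "\<rho> = min (min (1 / (2 * (C + 1))) \<epsilon>) (e / 2)"
  have \<rho>: "\<rho> > 0" "\<rho> \<le> \<epsilon>" "\<rho> \<le> e / 2" "\<rho> \<le> 1" "C * \<rho>\<^sup>2 \<le> 1 / 2"
  proof -
    show "\<rho> > 0" "\<rho> \<le> \<epsilon>" "\<rho> \<le> e / 2" using e \<epsilon> C_nonneg by (auto simp: \<rho>_def)
    then show "\<rho> \<le> 1" using e by linarith
    have "\<rho> \<le> 1 / (2 * (C + 1))" by (simp add: \<rho>_def)
    then have "\<rho> * (2 * (C + 1)) \<le> 1" using C_nonneg by (simp add: field_simps)
    then have "C * \<rho> \<le> 1 / 2" using \<open>\<rho> > 0\<close> by (simp add: algebra_simps)
    moreover have "C * \<rho> * \<rho> \<le> C * \<rho> * 1" using C_nonneg \<open>\<rho> > 0\<close> \<open>\<rho> \<le> 1\<close> by (intro mult_left_mono) auto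
    ultimately show "C * \<rho>\<^sup>2 \<le> 1 / 2" by (simp add: power2_eq_square algebra_simps)
  qed
  have "\<forall>\<^sub>F t in at_left c. t \<notin> N"
    using filter_leD[OF at_le[OF subset_UNIV]] islimpt_finite[OF N, of c]
    unfolding islimpt_iff_eventually by blast
  then have "\<forall>\<^sub>F t in at_left c. t \<notin> N \<and> norm (snd (\<gamma> t)) < \<rho>"
    using order_tendstoD(2)[OF limy \<rho>(1)] by eventually_elim simp
  then obtain p' where p': "p' < c" "\<forall>t>p'. t < c \<longrightarrow> t \<notin> N \<and> norm (snd (\<gamma> t)) < \<rho>"
    by (auto simp: eventually_at_left[OF c(1)])
  define p where "p = (max a p' + c) / 2"
  have p: "a < p" "p' < p" "p < c" using p' c by (auto simp: p_def)
  have sub: "{p<..<c} \<subseteq> {a..b} - N" using p p' c by auto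
  have derp: "(\<gamma> has_vector_derivative D t) (at t)" if "t \<in> {p<..<c}" for t using D sub that by blast
  have contp: "continuous_on {p<..<c} D" using contD sub by (rule continuous_on_subset)
  have smallp: "norm (snd (\<gamma> t)) \<le> \<rho>" if "t \<in> {p..c}" for t
  proof (cases "t = c")
    case True then show ?thesis using onc c \<rho> by simp
  next
    case False then show ?thesis using p'(2) p that by (auto intro: less_imp_le)
  qed
  define vl where "vl = (\<lambda>t. sqrt (axes_metric g (fst (\<gamma> t)) (fst (D t)) (fst (D t))))"
  have intl: "vl integrable_on {p..c}"
    unfolding vl_def
  proof (rule horizontal_speed_integrable)
    show "continuous_on {p..c} \<gamma>" by (rule continuous_on_subset[OF cont]) (use p c in auto)
    show "\<gamma> t \<in> U" if "t \<in> {p<..<c}" for t using inU p c that by auto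
    show "norm (snd (\<gamma> t)) \<le> \<rho>" if "t \<in> {p<..<c}" for t using smallp that by auto
    have "curve_length g a b \<gamma> = curve_length g a p \<gamma> + (curve_length g p c \<gamma> + curve_length g c b \<gamma>)"
      using curve_length_combine[of a p b g \<gamma>] curve_length_combine[of p c b g \<gamma>] p c by simp
    then show "curve_length g p c \<gamma> < \<infinity>" using fin by (auto simp: ennreal_add_eq_top less_top)
  qed (use p \<rho> derp contp in auto)
  have "continuous_on {p..c} (\<lambda>t. integral {p..t} vl)" by (rule indefinite_integral_continuous_1[OF intl])
  \<comment> \<open>Only finite length makes \<open>vl\<close> integrable up to \<open>c\<close>, where \<open>D\<close> may be unbounded; this is what
    forces \<open>l\<close> to tend to \<open>0\<close>.\<close>
  from continuous_on_Icc_at_leftD[OF this p(3)]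
  have "((\<lambda>t. integral {p..c} vl - integral {p..t} vl) \<longlongrightarrow> integral {p..c} vl - integral {p..c} vl) (at_left c)"
    by (intro tendsto_intros)
  then have "\<forall>\<^sub>F t in at_left c. integral {p..c} vl - integral {p..t} vl < e / 2"
    using e by (intro order_tendstoD(2)) auto
  then obtain q' where q': "q' < c" "\<forall>t>q'. t < c \<longrightarrow> integral {p..c} vl - integral {p..t} vl < e / 2"
    by (auto simp: eventually_at_left[OF c(1)])
  define q where "q = (max p q' + c) / 2"
  have q: "p < q" "q' < q" "q < c" using q' p by (auto simp: q_def)
  \<comment> \<open>Starting at a maximum of \<open>norm y\<close> makes the height \<open>r\<close> at \<open>t\<^sub>0\<close> bound the metric error along the
    whole replaced piece, so that gain and error are compared in the same quantity.\<close>
  have "continuous_on {q..c} (\<lambda>t. norm (snd (\<gamma> t)))"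
    by (intro continuous_intros continuous_on_subset[OF cont]) (use p q c in auto)
  then obtain t\<^sub>0 where t0: "t\<^sub>0 \<in> {q..c}" "\<forall>t\<in>{q..c}. norm (snd (\<gamma> t)) \<le> norm (snd (\<gamma> t\<^sub>0))"
    using continuous_attains_sup[of "{q..c}" "\<lambda>t. norm (snd (\<gamma> t))"] q by auto
  have "norm (snd (\<gamma> q)) > 0" using offc p q by simp
  then have "norm (snd (\<gamma> t\<^sub>0)) > 0" using t0(2) q by (meson atLeastAtMost_iff less_le_trans less_imp_le order_refl)
  then have "t\<^sub>0 \<noteq> c" using onc c by auto
  then have t0': "p < t\<^sub>0" "q' < t\<^sub>0" "t\<^sub>0 < c" using t0 q by auto
  define r where "r = norm (snd (\<gamma> t\<^sub>0))"
  have r\<rho>: "r \<le> \<rho>" unfolding r_def using t0' by (intro smallp) auto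
  define l where "l = integral {t\<^sub>0..c} vl"
  have "vl integrable_on {t\<^sub>0..c}" using intl t0' by (auto intro: integrable_subinterval_real)
  then have l: "(vl has_integral l) {t\<^sub>0..c}" unfolding l_def by (rule integrable_integral)
  have "integral {p..t\<^sub>0} vl + l = integral {p..c} vl"
    unfolding l_def using intl t0' by (intro Henstock_Kurzweil_Integration.integral_combine) auto
  moreover have "integral {p..c} vl - integral {p..t\<^sub>0} vl < e / 2" using q'(2) t0' by blast
  ultimately have le2: "l < e / 2" by linarith
  let ?\<delta> = "freeze_drop \<gamma> t\<^sub>0 c\<^sub>1 c\<^sub>2"
  have subt: "{t\<^sub>0<..<c} \<subseteq> {p<..<c}" using t0' by auto
  have tube': "\<forall>t\<in>{a..b}. \<forall>y. norm y \<le> r \<longrightarrow> (fst (\<gamma> t), y) \<in> U"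
    using tube r\<rho> \<rho>(2) by (meson order_trans)
  have "C * r\<^sup>2 \<le> C * \<rho>\<^sup>2" using r\<rho> C_nonneg by (intro mult_left_mono power_mono) (auto simp: r_def)
  then have Cr: "C * r\<^sup>2 \<le> 1" using \<rho> by linarith
  have "off_axes_then_geodesic U g a b ?\<delta>"
    by (rule off_axes_freeze_drop[OF crv _ t0'(3) c1(1,3) c2(2) offc onc tube'[unfolded r_def] geo nonconst2])
      (use p t0' in simp)
  moreover have "curve_length g a b ?\<delta> < curve_length g a b \<gamma>"
  proof (rule freeze_drop_shorter[OF _ t0'(3) c1(1,3) c2(2) cont inU _ _ u offc onc r_def _ Cr _ tube' l[unfolded vl_def]
        v0[unfolded vr_def] J[unfolded vr_def] K_def _ e(2,3) fin])
    show "\<forall>t\<in>{t\<^sub>0<..<c}. (\<gamma> has_vector_derivative D t) (at t)" using derp subt by blast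
    show "continuous_on {t\<^sub>0<..<c} D" using contp subt by (rule continuous_on_subset)
    show "\<forall>t\<in>{t\<^sub>0..c}. norm (snd (\<gamma> t)) \<le> r" using t0 by (auto simp: r_def)
  qed (use p t0' r\<rho> \<rho> le2 in auto)
  moreover have "?\<delta> a = \<gamma> a" "?\<delta> b = \<gamma> b" using p t0' c1 c2 by (auto simp: freeze_drop_def)
  ultimately show ?thesis by blast
qed

end

section \<open>The shorter curve\<close>

theorem proposition11:
  fixes U :: "('m::finite, 'n::finite) space set"
    and g :: "('m, 'n) space tensor2"
    and \<gamma> :: "real \<Rightarrow> ('m, 'n) space"
    and a b :: real
  assumes "product_cuspidal_metric U g"
    and "off_axes_then_geodesic U g a b \<gamma>"
  shows "\<not> length_minimizing U g a b \<gamma> \<and>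
    (\<exists>a' b' \<gamma>'. off_axes_then_geodesic U g a' b' \<gamma>' \<and>
       \<gamma>' a' = \<gamma> a \<and> \<gamma>' b' = \<gamma> b \<and>
       curve_length g a' b' \<gamma>' < curve_length g a b \<gamma>)"
proof -
  obtain C where "cuspidal_estimates U g C"
    by (rule product_cuspidal_metric_estimates[OF assms(1)])
  then interpret cuspidal_estimates U g C .
  have shorter: "\<exists>a' b' \<gamma>'. off_axes_then_geodesic U g a' b' \<gamma>' \<and>
       \<gamma>' a' = \<gamma> a \<and> \<gamma>' b' = \<gamma> b \<and> curve_length g a' b' \<gamma>' < curve_length g a b \<gamma>"
  proof (cases "curve_length g a b \<gamma> < \<infinity>")
    case True
    from shorter_competitor[OF assms(2) True] show ?thesis by blast
  next
    case False
    obtain a' \<delta> where "off_axes_then_geodesic U g a' b \<delta>" "\<delta> a' = \<gamma> a" "\<delta> b = \<gamma> b"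
      "curve_length g a' b \<delta> < \<infinity>"
      by (rule finite_length_competitor[OF assms(2)])
    moreover have "curve_length g a b \<gamma> = \<infinity>" using False unfolding infinity_ennreal_def less_top[symmetric] by blast
    ultimately show ?thesis by (intro exI[of _ a'] exI[of _ b] exI[of _ \<delta>]) simp
  qed
  moreover have "\<not> length_minimizing U g a b \<gamma>"
    using shorter unfolding length_minimizing_def off_axes_then_geodesic_def by (meson leD)
  ultimately show ?thesis by blast
qed

end
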